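(* Let $\alpha>-1/2$, let $S\subset(0,\infty)$ be a bounded measurable set, and let $\{t_n\}\subset(0,\infty)$ be a set of points separated by at least some positive distance $d$ (that is, $|t_n-t_m|\ge d$ for $n\ne m$). Then there exists a constant $B$ such that, for every $g\in\mathcal{B}_\alpha(S)$, $$\sum_n|g(t_n)|^2\le B\,\|g\|^2 .$$
   Context: $J_\alpha$ is the Bessel function of the first kind of order $\alpha$. The Hankel transform is $H_\alpha(f)(x)=\int_0^\infty f(t)(xt)^{1/2}J_\alpha(xt)\,dt$, extended to a unitary involution of $L^2(0,\infty)$. $\mathcal{B}_\alpha(S)$ is the space of $f\in L^2(0,\infty)$ whose Hankel transform is supported in $S$ (i.e. vanishes a.e. outside $S$). Since $S$ is bounded, each $f\in\mathcal{B}_\alpha(S)$ is identified with its continuous representative $f(t)=\int_S H_\alpha f(x)(tx)^{1/2}J_\alpha(tx)\,dx$, so point values make sense. $\|\cdot\|$ is the norm of $L^2(0,\infty)$. *)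

theory Defs
  imports "HOL-Analysis.Analysis"
begin

abbreviation halfline :: "real measure" where
  "halfline \<equiv> lebesgue_on {0<..}"

text \<open>Bessel function of the first kind of real order, for arguments \<open>x > 0\<close> only: by the convention
  \<open>0 powr a = 0\<close> the value at \<open>x = 0\<close> is \<open>0\<close>, also for order \<open>0\<close>.\<close>

definition bessel_J :: "real \<Rightarrow> real \<Rightarrow> real" where
  "bessel_J \<alpha> x =
     (\<Sum>k. (-1) ^ k / (fact k * Gamma (\<alpha> + real k + 1)) * (x / 2) powr (2 * real k + \<alpha>))"

text \<open>Square-integrable functions are represented by functions, not by classes modulo null sets;
  values outside \<open>{0<..}\<close> are irrelevant.\<close>

definition L2_halfline :: "(real \<Rightarrow> complex) set" where
  "L2_halfline =
     {f \<in> borel_measurable halfline. integrable halfline (\<lambda>t. (cmod (f t))\<^sup>2)}"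

definition L2_norm :: "(real \<Rightarrow> complex) \<Rightarrow> real" where
  "L2_norm f = sqrt (LINT t|halfline. (cmod (f t))\<^sup>2)"

definition hankel_integral :: "real \<Rightarrow> (real \<Rightarrow> complex) \<Rightarrow> real \<Rightarrow> complex" where
  "hankel_integral \<alpha> f x =
     (LINT t|halfline. f t * of_real (sqrt (x * t) * bessel_J \<alpha> (x * t)))"

text \<open>\<open>h\<close> is a version of the Hankel transform of \<open>f\<close> on \<open>L\<^sup>2(0,\<infinity>)\<close>. The transform on \<open>L\<^sup>2\<close> is the
  extension by continuity of the integral transform on \<open>L\<^sup>1 \<inter> L\<^sup>2\<close>, so its graph is the closure of
  the graph of the latter.\<close>

definition has_hankel_transform ::
  "real \<Rightarrow> (real \<Rightarrow> complex) \<Rightarrow> (real \<Rightarrow> complex) \<Rightarrow> bool" where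
  "has_hankel_transform \<alpha> f h \<longleftrightarrow>
     f \<in> L2_halfline \<and> h \<in> L2_halfline \<and>
     (\<exists>F :: nat \<Rightarrow> real \<Rightarrow> complex.
        (\<forall>n. integrable halfline (F n) \<and> F n \<in> L2_halfline \<and>
             hankel_integral \<alpha> (F n) \<in> L2_halfline) \<and>
        (\<lambda>n. L2_norm (\<lambda>t. F n t - f t)) \<longlonglongrightarrow> 0 \<and>
        (\<lambda>n. L2_norm (\<lambda>x. hankel_integral \<alpha> (F n) x - h x)) \<longlonglongrightarrow> 0)"

text \<open>All representatives of the elements of \<open>\<B>\<^sub>\<alpha>(S)\<close>. For point values one has to select the
  representative that is continuous on \<open>{0<..}\<close>.\<close>

definition hankel_band_limited :: "real \<Rightarrow> real set \<Rightarrow> (real \<Rightarrow> complex) set" where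
  "hankel_band_limited \<alpha> S =
     {f \<in> L2_halfline. \<exists>h. has_hankel_transform \<alpha> f h \<and>
        (AE x in halfline. x \<notin> S \<longrightarrow> h x = 0)}"

end

theory Submission
  imports Defs
begin

text \<open>
Write \<open>k(y) = sqrt y J\<^sub>\<alpha>(y)\<close> and \<open>H\<close> for the integral operator with kernel \<open>k(x t)\<close>. The kernel is
bounded, by an energy estimate for Bessel's equation. The transform maps \<open>t\<^bsup>\<alpha>+1/2\<^esup> exp(- a t\<^sup>2)\<close> to a
multiple of a function of the same form, so on the span of these functions it is involutive, hence
isometric by Fubini. The span is dense in \<open>L\<^sup>1 \<inter> L\<^sup>2\<close> (Weierstrass in the variable \<open>exp(- x\<^sup>2)\<close>), and
Fatou's lemma carries the \<open>L\<^sup>2\<close> bound over to \<open>L\<^sup>1 \<inter> L\<^sup>2\<close>. Consequently \<open>g = H h\<close> for a band-limited \<open>g\<close>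
with transform \<open>h\<close>. The derivative of \<open>H h\<close> is \<open>(\<alpha> + 1/2)/u H h(u)\<close> minus the transform of order
\<open>\<alpha> + 1\<close> of \<open>x h(x)\<close>, so by the \<open>L\<^sup>2\<close> bound for that order it is square integrable away from \<open>0\<close>.
Averaging over the disjoint intervals \<open>[t\<^sub>n, t\<^sub>n + d)\<close> bounds the sum over the points \<open>t\<^sub>n \<ge> d\<close>; at
most one point is smaller than \<open>d\<close>, where the supremum bound for \<open>H h\<close> suffices.
\<close>

subsection \<open>Boundedness of the kernel\<close>

text \<open>Estimates use squared norms and |a + b|^2 <= 2 |a|^2 + 2 |b|^2, so constants are not
  sharp: the \<open>L^2\<close> bound carries a factor 2 although the transform is isometric. Only
  the existence of a constant matters. A pair (g, h) is given as an \<open>L^2\<close> limit of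
  pairs (F, H F), so H h makes sense as an integral only once h is integrable. Boundedness of
  \<open>S\<close> supplies this through Cauchy-Schwarz. The resulting identity g = H h holds almost
  everywhere, while the sampling points form a null set; continuity of both sides closes the gap.
  Density is needed in \<open>L^1\<close> and \<open>L^2\<close> at once: closeness in
  \<open>L^1\<close> makes the transforms converge pointwise, as Fatou requires, and closeness in
  \<open>L^2\<close> bounds their norms. In the sampling step the coefficient (\<alpha> + 1/2)/u is
  unbounded near 0, which forces the split at d. The other term of the derivative costs only a
  factor R when \<open>S\<close> lies in (0, R], the second use of boundedness.\<close>

definition bessel_coeff :: "real \<Rightarrow> nat \<Rightarrow> real" where
  "bessel_coeff \<alpha> k = (-1) ^ k / (fact k * Gamma (\<alpha> + real k + 1))"

text \<open>The entire factor of the Bessel function: \<open>bessel_J \<alpha> y\<close> is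
  \<open>(y / 2) powr \<alpha>\<close> times its value at \<open>y\<^sup>2 / 4\<close>.\<close>

definition bessel_entire :: "real \<Rightarrow> real \<Rightarrow> real" where
  "bessel_entire \<alpha> z = (\<Sum>k. bessel_coeff \<alpha> k * z ^ k)"

definition hankel_kernel :: "real \<Rightarrow> real \<Rightarrow> real" where
  "hankel_kernel \<alpha> y = sqrt y * bessel_J \<alpha> y"

section \<open>Power series and recurrences of the Bessel function\<close>

lemma Gamma_real_plus1: "x > 0 \<Longrightarrow> Gamma (x + 1) = x * Gamma (x :: real)"
  using nonpos_Ints_nonpos[of x] by (intro Gamma_plus1) auto

lemma bessel_coeff_Suc:
  assumes "\<alpha> > -1"
  shows "bessel_coeff \<alpha> (Suc k) = - bessel_coeff \<alpha> k / (real (Suc k) * (\<alpha> + real k + 1))"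
proof -
  have "Gamma (\<alpha> + real (Suc k) + 1) = (\<alpha> + real k + 1) * Gamma (\<alpha> + real k + 1)"
    using Gamma_real_plus1[of "\<alpha> + real k + 1"] assms by (simp add: add_ac)
  then show ?thesis
    by (simp add: bessel_coeff_def field_simps)
qed

lemma bessel_coeff_add_1:
  assumes "\<alpha> > -1"
  shows "bessel_coeff \<alpha> (Suc k) * real (Suc k) = - bessel_coeff (\<alpha> + 1) k"
proof -
  have "\<alpha> + real (Suc k) + 1 = \<alpha> + 1 + real k + 1" by simp
  then show ?thesis
    unfolding bessel_coeff_def by (simp only:) (simp add: field_simps del: of_nat_Suc)
qed

lemma summable_bessel_coeff:
  assumes "\<alpha> > -1"
  shows "summable (\<lambda>k. bessel_coeff \<alpha> k * z ^ k)"
proof (rule summable_ratio_test)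
  \<comment> \<open>For \<open>n \<ge> N\<close> the factor \<open>\<alpha> + real n + 1\<close>
    exceeds 1 because \<open>n \<ge> 1\<close>, so \<open>real (Suc n)\<close> alone makes the
    denominator at least \<open>2 * \<bar>z\<bar>\<close>.\<close>
  define N where "N = Suc (nat \<lceil>2 * \<bar>z\<bar>\<rceil>)"
  show "norm (bessel_coeff \<alpha> (Suc n) * z ^ Suc n) \<le> 1 / 2 * norm (bessel_coeff \<alpha> n * z ^ n)"
    if "n \<ge> N" for n
  proof -
    have "2 * \<bar>z\<bar> \<le> real n" "n \<ge> 1"
      using that unfolding N_def by linarith+
    have "real (Suc n) * 1 \<le> real (Suc n) * (\<alpha> + real n + 1)"
      using assms \<open>n \<ge> 1\<close> by (intro mult_left_mono) auto
    then have *: "2 * \<bar>z\<bar> \<le> real (Suc n) * (\<alpha> + real n + 1)"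
      using \<open>2 * \<bar>z\<bar> \<le> real n\<close> by (intro order_trans[OF _ \<open>real (Suc n) * 1 \<le> _\<close>]) simp
    have pos: "real (Suc n) * (\<alpha> + real n + 1) > 0"
      using assms \<open>n \<ge> 1\<close> by (intro mult_pos_pos) auto
    have "norm (bessel_coeff \<alpha> (Suc n) * z ^ Suc n)
        = \<bar>z\<bar> / (real (Suc n) * (\<alpha> + real n + 1)) * norm (bessel_coeff \<alpha> n * z ^ n)"
      unfolding bessel_coeff_Suc[OF assms]
      using pos by (simp add: abs_of_pos[OF pos] norm_mult norm_divide mult_ac del: of_nat_Suc flip: abs_mult)
    also have "\<dots> \<le> 1 / 2 * norm (bessel_coeff \<alpha> n * z ^ n)"
      using * pos by (intro mult_right_mono) (auto simp: divide_simps simp del: of_nat_Suc)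
    finally show ?thesis .
  qed
qed simp

lemma bessel_entire_deriv:
  assumes "\<alpha> > -1"
  shows "(bessel_entire \<alpha> has_real_derivative - bessel_entire (\<alpha> + 1) z) (at z)"
proof -
  have "diffs (bessel_coeff \<alpha>) = (\<lambda>k. - bessel_coeff (\<alpha> + 1) k)"
    using bessel_coeff_add_1[OF assms] by (auto simp: diffs_def mult.commute)
  then have "((\<lambda>x. \<Sum>k. bessel_coeff \<alpha> k * x ^ k) has_real_derivative
      (\<Sum>k. - bessel_coeff (\<alpha> + 1) k * z ^ k)) (at z)"
    using termdiffs_strong_converges_everywhere[of "bessel_coeff \<alpha>" z]
      summable_bessel_coeff[OF assms] by simp
  moreover have "(\<Sum>k. - bessel_coeff (\<alpha> + 1) k * z ^ k) = - bessel_entire (\<alpha> + 1) z"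
    using summable_bessel_coeff[of "\<alpha> + 1" z] assms
    by (simp add: bessel_entire_def suminf_minus)
  ultimately show ?thesis
    by (simp add: bessel_entire_def[abs_def])
qed

text \<open>This is the classical recurrence J_\<alpha> + J_(\<alpha>+2) = 2 (\<alpha> + 1)/y
  J_(\<alpha>+1) with z = y^2/4 and the powers of y removed. The coefficients of each z^k agree by
  the functional equation of Gamma.\<close>

lemma bessel_entire_recurrence:
  assumes "\<alpha> > -1"
  shows "bessel_entire \<alpha> z = (\<alpha> + 1) * bessel_entire (\<alpha> + 1) z - z * bessel_entire (\<alpha> + 2) z"
proof -
  have s: "summable (\<lambda>k. bessel_coeff \<beta> k * z ^ k)" if "\<beta> > -1" for \<beta>
    using that by (rule summable_bessel_coeff)
  \<comment> \<open>The series of z times the entire factor of order \<open>\<alpha> + 2\<close>,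
    shifted by one index so that it can be compared with the others at the same power of z.\<close>
  define b where "b k = (case k of 0 \<Rightarrow> 0 | Suc j \<Rightarrow> bessel_coeff (\<alpha> + 2) j * z ^ Suc j)" for k
  have "(\<lambda>j. bessel_coeff (\<alpha> + 2) j * z ^ j * z) sums (bessel_entire (\<alpha> + 2) z * z)"
    unfolding bessel_entire_def using s[of "\<alpha> + 2"] assms by (intro sums_mult2 summable_sums) auto
  then have b: "b sums (bessel_entire (\<alpha> + 2) z * z)"
    by (subst sums_Suc_iff[of b, simplified b_def[of 0], simplified, symmetric])
       (simp add: b_def mult_ac)
  have "(\<lambda>k. (\<alpha> + 1) * (bessel_coeff (\<alpha> + 1) k * z ^ k) - b k) sums
        ((\<alpha> + 1) * bessel_entire (\<alpha> + 1) z - bessel_entire (\<alpha> + 2) z * z)"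
    unfolding bessel_entire_def[of "\<alpha> + 1"] using s[of "\<alpha> + 1"] assms
    by (intro sums_diff sums_mult summable_sums b) auto
  moreover have "(\<alpha> + 1) * (bessel_coeff (\<alpha> + 1) k * z ^ k) - b k = bessel_coeff \<alpha> k * z ^ k" for k
  proof (cases k)
    case 0
    have "Gamma (\<alpha> + 1 + 1) = (\<alpha> + 1) * Gamma (\<alpha> + 1)"
      using assms by (intro Gamma_real_plus1) auto
    then show ?thesis using 0 assms
      by (simp add: b_def bessel_coeff_def add_ac)
  next
    case (Suc j)
    have "Gamma (\<alpha> + real k + 1 + 1) = (\<alpha> + real k + 1) * Gamma (\<alpha> + real k + 1)"
      using assms by (intro Gamma_real_plus1) auto
    then have G: "Gamma (\<alpha> + real k + 2) = (\<alpha> + real k + 1) * Gamma (\<alpha> + real k + 1)"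
      by (simp add: add_ac)
    have nz: "\<alpha> + real k + 1 > 0" "Gamma (\<alpha> + real k + 1) > 0"
      using assms by (auto intro: Gamma_real_pos)
    have 1: "bessel_coeff (\<alpha> + 1) k = bessel_coeff \<alpha> k / (\<alpha> + real k + 1)"
      using nz G by (simp add: bessel_coeff_def add_ac)
    have "bessel_coeff (\<alpha> + 2) j = (-1) ^ j / (fact j * Gamma (\<alpha> + real k + 2))"
      using Suc by (simp add: bessel_coeff_def add_ac)
    also have "\<dots> = - bessel_coeff \<alpha> k * real k / (\<alpha> + real k + 1)"
      unfolding G using nz Suc by (simp add: bessel_coeff_def field_simps del: of_nat_Suc)
    finally have 2: "bessel_coeff (\<alpha> + 2) j = - bessel_coeff \<alpha> k * real k / (\<alpha> + real k + 1)" .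
    have "(\<alpha> + 1) * (bessel_coeff (\<alpha> + 1) k * z ^ k) - b k
        = ((\<alpha> + 1) * bessel_coeff (\<alpha> + 1) k - bessel_coeff (\<alpha> + 2) j) * z ^ k"
      using Suc by (simp add: b_def algebra_simps)
    also have "(\<alpha> + 1) * bessel_coeff (\<alpha> + 1) k - bessel_coeff (\<alpha> + 2) j = bessel_coeff \<alpha> k"
    proof -
      have "(\<alpha> + 1) * (bessel_coeff \<alpha> k / (\<alpha> + real k + 1)) -
          - bessel_coeff \<alpha> k * real k / (\<alpha> + real k + 1)
        = bessel_coeff \<alpha> k * (\<alpha> + real k + 1) / (\<alpha> + real k + 1)"
        by (simp add: algebra_simps add_divide_distrib)
      then show ?thesis unfolding 1 2 using nz by simp
    qed
    finally show ?thesis .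
  qed
  ultimately have "(\<lambda>k. bessel_coeff \<alpha> k * z ^ k) sums
        ((\<alpha> + 1) * bessel_entire (\<alpha> + 1) z - bessel_entire (\<alpha> + 2) z * z)"
    by simp
  then show ?thesis
    by (simp add: bessel_entire_def sums_iff mult.commute)
qed

lemma hankel_kernel_eq:
  assumes "y > 0" "\<alpha> > -1"
  shows "hankel_kernel \<alpha> y = 2 powr (- \<alpha>) * y powr (\<alpha> + 1 / 2) * bessel_entire \<alpha> (y\<^sup>2 / 4)"
proof -
  have "bessel_J \<alpha> y = (\<Sum>k. (y / 2) powr \<alpha> * (bessel_coeff \<alpha> k * (y\<^sup>2 / 4) ^ k))"
    unfolding bessel_J_def
  proof (rule suminf_cong)
    fix k :: nat
    have "(y / 2) powr (2 * real k + \<alpha>) = (y / 2) powr real (2 * k) * (y / 2) powr \<alpha>"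
      by (simp add: powr_add)
    also have "(y / 2) powr real (2 * k) = (y\<^sup>2 / 4) ^ k"
      using assms by (subst powr_realpow) (auto simp: power_mult power_divide)
    finally show "(- 1) ^ k / (fact k * Gamma (\<alpha> + real k + 1)) * (y / 2) powr (2 * real k + \<alpha>)
        = (y / 2) powr \<alpha> * (bessel_coeff \<alpha> k * (y\<^sup>2 / 4) ^ k)"
      by (simp add: bessel_coeff_def)
  qed
  also have "\<dots> = (y / 2) powr \<alpha> * bessel_entire \<alpha> (y\<^sup>2 / 4)"
    unfolding bessel_entire_def using assms
    by (intro suminf_mult summable_bessel_coeff)
  moreover have "y powr (\<alpha> + 1 / 2) = y powr \<alpha> * sqrt y"
    using assms by (simp add: powr_add powr_half_sqrt)
  ultimately show ?thesis
    using assms by (simp add: hankel_kernel_def powr_divide powr_minus_divide)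
qed

text \<open>Order \<open>\<alpha> + 1\<close> is written with the prefactor of order
  \<open>\<alpha>\<close>, so that both kernels fit into one formula.\<close>

lemma hankel_kernel_shift:
  assumes "y > 0" "\<alpha> > -1"
  shows "hankel_kernel (\<alpha> + 1) y =
      2 powr (- \<alpha>) * y powr (\<alpha> + 1 / 2) * (y / 2) * bessel_entire (\<alpha> + 1) (y\<^sup>2 / 4)"
proof -
  have "y powr (\<alpha> + 1 + 1 / 2) = y powr (\<alpha> + 1 / 2) * y"
    using assms powr_add[of y "\<alpha> + 1 / 2" 1] by (simp add: add_ac)
  moreover have "2 powr (- (\<alpha> + 1)) = 2 powr (- \<alpha>) / (2::real)"
    using powr_add[of "2::real" "- \<alpha>" "- 1"] by (simp add: powr_minus)
  ultimately show ?thesis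
    using assms hankel_kernel_eq[of y "\<alpha> + 1"] by simp
qed

text \<open>Bessel's rule J_\<alpha>' = (\<alpha>/y) J_\<alpha> - J_(\<alpha>+1); the additional 1/2
  comes from differentiating sqrt y.\<close>

lemma hankel_kernel_deriv:
  assumes "y > 0" "\<alpha> > -1"
  shows "(hankel_kernel \<alpha> has_real_derivative
    ((\<alpha> + 1 / 2) / y * hankel_kernel \<alpha> y - hankel_kernel (\<alpha> + 1) y)) (at y)"
proof -
  define g where "g = (\<lambda>y. 2 powr (- \<alpha>) * y powr (\<alpha> + 1 / 2) * bessel_entire \<alpha> (y\<^sup>2 / 4))"
  note [derivative_intros] = DERIV_chain2[OF bessel_entire_deriv[OF assms(2)]]
  have 1: "y powr (\<alpha> - 1 / 2) = y powr (\<alpha> + 1 / 2) / y"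
    using assms powr_diff[of y "\<alpha> + 1 / 2" 1] by simp
  have "(g has_real_derivative
     2 powr (- \<alpha>) * (y powr (\<alpha> + 1 / 2) * ((\<alpha> + 1 / 2) / y)) * bessel_entire \<alpha> (y\<^sup>2 / 4)
     + 2 powr (- \<alpha>) * y powr (\<alpha> + 1 / 2) * (- bessel_entire (\<alpha> + 1) (y\<^sup>2 / 4) * (y / 2))) (at y)"
    unfolding g_def using assms
    using assms by (auto intro!: derivative_eq_intros simp: 1 right_diff_distrib mult_ac)
  also have "2 powr (- \<alpha>) * (y powr (\<alpha> + 1 / 2) * ((\<alpha> + 1 / 2) / y)) * bessel_entire \<alpha> (y\<^sup>2 / 4)
     + 2 powr (- \<alpha>) * y powr (\<alpha> + 1 / 2) * (- bessel_entire (\<alpha> + 1) (y\<^sup>2 / 4) * (y / 2))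
     = (\<alpha> + 1 / 2) / y * hankel_kernel \<alpha> y - hankel_kernel (\<alpha> + 1) y"
    unfolding hankel_kernel_shift[OF assms] hankel_kernel_eq[OF assms] by (simp add: mult_ac)
  finally have "(g has_real_derivative
      ((\<alpha> + 1 / 2) / y * hankel_kernel \<alpha> y - hankel_kernel (\<alpha> + 1) y)) (at y)" .
  then show ?thesis
    by (rule has_field_derivative_transform_within_open[where S = "{0<..}"])
       (use assms in \<open>simp_all add: g_def hankel_kernel_eq\<close>)
qed

lemma hankel_kernel_recurrence:
  assumes "y > 0" "\<alpha> > -1"
  shows "hankel_kernel (\<alpha> + 2) y = 2 * (\<alpha> + 1) / y * hankel_kernel (\<alpha> + 1) y - hankel_kernel \<alpha> y"
proof -
  define P where "P = 2 powr (- \<alpha>) * y powr (\<alpha> + 1 / 2)"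
  have 0: "hankel_kernel \<alpha> y = P * bessel_entire \<alpha> (y\<^sup>2 / 4)"
    and 1: "hankel_kernel (\<alpha> + 1) y = P * (y / 2) * bessel_entire (\<alpha> + 1) (y\<^sup>2 / 4)"
    using assms by (simp add: P_def hankel_kernel_eq, simp add: P_def hankel_kernel_shift)
  have "2 powr (- (\<alpha> + 1)) * y powr (\<alpha> + 1 + 1 / 2) = P * (y / 2)"
  proof -
    have "y powr (\<alpha> + 1 + 1 / 2) = y powr (\<alpha> + 1 / 2) * y"
      using assms powr_add[of y "\<alpha> + 1 / 2" 1] by (simp add: add_ac)
    moreover have "2 powr (- (\<alpha> + 1)) = 2 powr (- \<alpha>) / (2::real)"
      using powr_add[of "2::real" "- \<alpha>" "- 1"] by (simp add: powr_minus)
    ultimately show ?thesis by (simp add: P_def)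
  qed
  moreover have "hankel_kernel (\<alpha> + 1 + 1) y = 2 powr (- (\<alpha> + 1)) * y powr (\<alpha> + 1 + 1 / 2) *
      (y / 2) * bessel_entire (\<alpha> + 1 + 1) (y\<^sup>2 / 4)"
    using assms by (intro hankel_kernel_shift) auto
  moreover have "\<alpha> + 1 + 1 = \<alpha> + 2" by simp
  ultimately have 2: "hankel_kernel (\<alpha> + 2) y = P * (y / 2) * (y / 2) * bessel_entire (\<alpha> + 2) (y\<^sup>2 / 4)"
    by (simp only:)
  show ?thesis
    unfolding 0 1 2 bessel_entire_recurrence[OF assms(2)]
    using assms by (simp add: field_simps power2_eq_square)
qed

text \<open>The recurrence eliminates order \<open>\<alpha> + 2\<close>, so the kernels of orders
  \<open>\<alpha>\<close> and \<open>\<alpha> + 1\<close> satisfy a closed first-order system. This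
  yields the second-order equation for the kernel.\<close>

lemma hankel_kernel_add_1_deriv:
  assumes "y > 0" "\<alpha> > -1"
  shows "(hankel_kernel (\<alpha> + 1) has_real_derivative
    (hankel_kernel \<alpha> y - (\<alpha> + 1 / 2) / y * hankel_kernel (\<alpha> + 1) y)) (at y)"
proof -
  have "(\<alpha> + 1 + 1 / 2) / y * hankel_kernel (\<alpha> + 1) y - hankel_kernel (\<alpha> + 1 + 1) y
      = hankel_kernel \<alpha> y - (\<alpha> + 1 / 2) / y * hankel_kernel (\<alpha> + 1) y"
    using hankel_kernel_recurrence[OF assms] assms by (simp add: add.assoc field_simps)
  then show ?thesis
    using hankel_kernel_deriv[of y "\<alpha> + 1"] assms by simp
qed

lemma continuous_on_hankel_kernel:
  assumes "\<alpha> > -1"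
  shows "continuous_on {0<..} (hankel_kernel \<alpha>)"
  using hankel_kernel_deriv[OF _ assms]
  by (intro continuous_at_imp_continuous_on ballI) (auto intro: DERIV_isCont)

text \<open>The kernel solves \<open>u'' = (c / y\<^sup>2 - 1) u\<close>, so its energy \<open>u\<^sup>2 + u'\<^sup>2\<close> grows on \<open>{1..}\<close>
  at most at the integrable rate \<open>\<bar>c\<bar> / y\<^sup>2\<close>.\<close>

lemma hankel_kernel_bounded:
  assumes "\<alpha> > - 1 / 2"
  obtains M where "M > 0" "\<And>y. y > 0 \<Longrightarrow> \<bar>hankel_kernel \<alpha> y\<bar> \<le> M"
proof -
  define p where "p = \<alpha> + 1 / 2"
  \<comment> \<open>Equals \<alpha>^2 - 1/4, the coefficient in the normal form of Bessel's
    equation.\<close>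
  define c where "c = p\<^sup>2 - p"
  define u where "u = hankel_kernel \<alpha>"
  define v where "v = hankel_kernel (\<alpha> + 1)"
  define w where "w y = p / y * u y - v y" for y
  have du: "(u has_real_derivative w y) (at y)" if "y > 0" for y
    using hankel_kernel_deriv[OF that, of \<alpha>] assms by (simp add: u_def v_def w_def p_def)
  have dv: "(v has_real_derivative u y - p / y * v y) (at y)" if "y > 0" for y
    using hankel_kernel_add_1_deriv[OF that, of \<alpha>] assms by (simp add: u_def v_def p_def)
  have dw: "(w has_real_derivative (c / y\<^sup>2 - 1) * u y) (at y)" if "y > 0" for y
    unfolding w_def[abs_def] using that
    by (auto intro!: derivative_eq_intros du dv simp: w_def c_def field_simps power2_eq_square)
  \<comment> \<open>An integrating factor: the derivative of \<open>exp (\<bar>c\<bar> / y)\<close>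
    contributes \<open>- \<bar>c\<bar> / y\<^sup>2\<close> times the energy, which outweighs the
    derivative 2 c u w / y^2 of the energy itself. Hence \<open>E\<close> decreases, and it
    dominates \<open>(u y)\<^sup>2\<close> since the factor is at least 1.\<close>
  define E where "E y = exp (\<bar>c\<bar> / y) * ((u y)\<^sup>2 + (w y)\<^sup>2)" for y
  have dE: "(E has_real_derivative
      exp (\<bar>c\<bar> / y) * (2 * c * u y * w y - \<bar>c\<bar> * ((u y)\<^sup>2 + (w y)\<^sup>2)) / y\<^sup>2) (at y)" if "y > 0" for y
    unfolding E_def[abs_def] using that
    by (auto intro!: derivative_eq_intros du dw simp: field_simps power2_eq_square)
  have *: "2 * c * a * b \<le> \<bar>c\<bar> * (a\<^sup>2 + b\<^sup>2)" for a b :: real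
  proof -
    have "2 * c * a * b \<le> \<bar>c\<bar> * (2 * \<bar>a * b\<bar>)"
      by (metis abs_ge_self abs_mult abs_numeral mult.assoc mult.left_commute)
    also have "2 * \<bar>a * b\<bar> \<le> a\<^sup>2 + b\<^sup>2"
      using sum_squares_bound[of "\<bar>a\<bar>" "\<bar>b\<bar>"] by (simp add: abs_mult)
    finally show ?thesis by (simp add: mult_left_mono)
  qed
  have E_le: "E y \<le> E 1" if "y \<ge> 1" for y
  proof (rule DERIV_nonpos_imp_nonincreasing[OF that])
    fix x :: real assume "1 \<le> x" "x \<le> y"
    have "exp (\<bar>c\<bar> / x) * (2 * c * u x * w x - \<bar>c\<bar> * ((u x)\<^sup>2 + (w x)\<^sup>2)) / x\<^sup>2 \<le> 0"
      using * by (intro divide_nonpos_nonneg mult_nonneg_nonpos) auto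
    then show "\<exists>d. (E has_real_derivative d) (at x) \<and> d \<le> 0"
      using dE[of x] \<open>1 \<le> x\<close> by fastforce
  qed
  have big: "\<bar>u y\<bar> \<le> 1 + E 1" if "y \<ge> 1" for y
  proof -
    have "1 * (u y)\<^sup>2 \<le> E y"
      unfolding E_def using that by (intro mult_mono) auto
    then have "(u y)\<^sup>2 \<le> E 1" using E_le[OF that] by simp
    moreover have "\<bar>u y\<bar> \<le> 1 + (u y)\<^sup>2"
      using sum_squares_bound[of "\<bar>u y\<bar>" 1] zero_le_power2[of "u y"] by (auto simp: abs_le_iff)
    ultimately show ?thesis by simp
  qed
  have "continuous_on {0..1} (bessel_entire \<alpha>)"
    using bessel_entire_deriv[of \<alpha>] assms
    by (intro continuous_at_imp_continuous_on ballI) (auto intro: DERIV_isCont)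
  then have "bounded (bessel_entire \<alpha> ` {0..1})"
    by (intro compact_imp_bounded compact_continuous_image) auto
  then obtain B where "\<forall>z\<in>{0..1}. \<bar>bessel_entire \<alpha> z\<bar> \<le> B"
    by (auto simp: bounded_iff)
  then have B: "\<bar>bessel_entire \<alpha> z\<bar> \<le> B" if "0 \<le> z" "z \<le> 1" for z
    using that by simp
  \<comment> \<open>Near 0 the series gives the bound: \<open>\<alpha> > - 1 / 2\<close> makes the
    exponent of \<open>y\<close> positive, and \<open>y\<^sup>2 / 4\<close> stays in the interval on
    which \<open>B\<close> bounds the entire factor.\<close>
  have small: "\<bar>u y\<bar> \<le> 2 powr (- \<alpha>) * 1 * B" if "y > 0" "y \<le> 1" for y
  proof -
    have "\<bar>bessel_entire \<alpha> (y\<^sup>2 / 4)\<bar> \<le> B"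
      using that power_le_one[of y 2] by (intro B) auto
    moreover have "y powr (\<alpha> + 1 / 2) \<le> 1"
      using that assms by (intro powr_le1) auto
    moreover have "\<bar>u y\<bar> = 2 powr (- \<alpha>) * y powr (\<alpha> + 1 / 2) * \<bar>bessel_entire \<alpha> (y\<^sup>2 / 4)\<bar>"
      using that assms by (simp add: u_def hankel_kernel_eq abs_mult)
    ultimately show ?thesis
      by (simp only:) (intro mult_mono mult_left_mono; simp)
  qed
  have "E 1 \<ge> 0" "B \<ge> 0" using B[of 0] by (auto simp: E_def)
  show thesis
  proof (rule that[of "1 + E 1 + 2 powr (- \<alpha>) * B"])
    have nonneg: "2 powr (- \<alpha>) * B \<ge> 0"
      using \<open>B \<ge> 0\<close> by simp
    show "1 + E 1 + 2 powr (- \<alpha>) * B > 0"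
      using nonneg \<open>E 1 \<ge> 0\<close> by linarith
    show "\<bar>hankel_kernel \<alpha> y\<bar> \<le> 1 + E 1 + 2 powr (- \<alpha>) * B" if "y > 0" for y
      using big[of y] small[of y] that \<open>E 1 \<ge> 0\<close> nonneg unfolding u_def by linarith
  qed
qed

subsection \<open>Transforms of Gaussian-type functions\<close>

text \<open>Needed for Fubini on the product of \<open>halfline\<close> with itself. The countable
  cover for \<open>lborel\<close> also serves for its completion.\<close>

lemma sigma_finite_halfline: "sigma_finite_measure halfline"
proof -
  have "sigma_finite_measure (completion lborel :: real measure)"
  proof
    obtain A :: "real set set" where "countable A" "A \<subseteq> sets lborel" "\<Union>A = space lborel"
      "\<forall>a\<in>A. emeasure lborel a \<noteq> \<infinity>"
      using lborel.sigma_finite_countable by blast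
    then show "\<exists>A::real set set. countable A \<and> A \<subseteq> sets lebesgue \<and> \<Union>A = space lebesgue \<and>
        (\<forall>a\<in>A. emeasure lebesgue a \<noteq> \<infinity>)"
      by (intro exI[of _ A]) (auto simp: emeasure_completion main_part_sets)
  qed
  then show ?thesis
    by (intro sigma_finite_measure_restrict_space) auto
qed

interpretation halfline: sigma_finite_measure halfline
  by (rule sigma_finite_halfline)

interpretation halfline_pair: pair_sigma_finite halfline halfline ..

lemma space_halfline [simp]: "space halfline = {0<..}"
  by (simp add: space_restrict_space)

lemma halfline_measurable_id [measurable]: "(\<lambda>x. x) \<in> borel_measurable halfline"
  by (intro measurable_restrict_space1 measurable_completion) simp

text \<open>The Gamma integral under the substitution s = a t^2: the Jacobian 2 a t times (a t^2)^(b
  - 1) equals 2 a^b t^(2 b - 1), whence the exponent and the divisor.\<close>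

lemma has_bochner_integral_halfline_gaussian_powr:
  fixes a b :: real
  assumes "a > 0" "b > 0"
  shows "has_bochner_integral halfline (\<lambda>t. t powr (2 * b - 1) * exp (- a * t\<^sup>2))
    (Gamma b / (2 * a powr b))"
proof -
  let ?f = "\<lambda>t. t powr (b - 1) / exp t"
  let ?g = "\<lambda>t. a * t\<^sup>2"
  have "(?f has_integral Gamma b) {0<..}"
  proof -
    have "(?f has_integral Gamma b) {0..}"
      using assms by (intro Gamma_integral_real)
    then have "((\<lambda>t. if t \<in> {0<..} then ?f t else 0) has_integral Gamma b) {0..}"
      by (rule has_integral_spike[of "{0}", rotated 2]) auto
    then show ?thesis
      by (subst (asm) has_integral_restrict) auto
  qed
  then have f: "?f absolutely_integrable_on {0<..}" "integral {0<..} ?f = Gamma b"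
  proof -
    assume I: "(?f has_integral Gamma b) {0<..}"
    show "?f absolutely_integrable_on {0<..}"
      by (rule nonnegative_absolutely_integrable_1) (use I in \<open>auto simp: has_integral_integrable\<close>)
    show "integral {0<..} ?f = Gamma b"
      using I by (rule integral_unique)
  qed
  have img: "?g ` {0<..} = {0<..}"
  proof (intro equalityI subsetI)
    fix x :: real assume "x \<in> {0<..}"
    then have "x = ?g (sqrt (x / a))" "sqrt (x / a) \<in> {0<..}"
      using assms by auto
    then show "x \<in> ?g ` {0<..}" by blast
  qed (use assms in auto)
  have "inj_on ?g {0<..}"
    using assms by (auto intro!: inj_onI simp: power2_eq_iff)
  then have "(\<lambda>t. \<bar>2 * a * t\<bar> * ?f (?g t)) absolutely_integrable_on {0<..} \<and>
    integral {0<..} (\<lambda>t. \<bar>2 * a * t\<bar> * ?f (?g t)) = Gamma b"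
    using f by (subst has_absolute_integral_change_of_variables_1')
      (auto intro!: derivative_eq_intros simp: img)
  then have "has_bochner_integral halfline (\<lambda>t. \<bar>2 * a * t\<bar> * ?f (?g t)) (Gamma b)"
    by (simp add: has_bochner_integral_iff lebesgue_integral_eq_integral
        integrable_restrict_space set_integrable_def)
  then have "has_bochner_integral halfline (\<lambda>t. \<bar>2 * a * t\<bar> * ?f (?g t) / (2 * a powr b))
      (Gamma b / (2 * a powr b))"
    by (rule has_bochner_integral_divide_zero)
  moreover have "\<bar>2 * a * t\<bar> * ?f (?g t) / (2 * a powr b) = t powr (2 * b - 1) * exp (- a * t\<^sup>2)"
    if "t > 0" for t
  proof -
    have "?g t powr (b - 1) = a powr b / a * (t powr (2 * b - 1) / t)"
    proof -
      have "(t\<^sup>2) powr (b - 1) = t powr (2 * (b - 1))"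
        using that by (simp add: powr_powr flip: powr_numeral)
      also have "\<dots> = t powr (2 * b - 1) / t"
        using that powr_diff[of t "2 * b - 1" 1] by (simp add: algebra_simps)
      finally show ?thesis
        using assms by (simp add: powr_mult powr_diff[of a])
    qed
    then show ?thesis
      using assms that by (simp add: exp_minus field_simps)
  qed
  ultimately show ?thesis
    by (subst has_bochner_integral_cong[of halfline halfline]) auto
qed

text \<open>The power is that of the kernel at 0; integrating against the k-th term of the kernel
  series then gives a multiple of Gamma(\<alpha> + k + 1), exactly the value in the denominator of
  that term.\<close>

definition hankel_gaussian :: "real \<Rightarrow> real \<Rightarrow> real \<Rightarrow> real" where
  "hankel_gaussian \<alpha> a t = t powr (\<alpha> + 1 / 2) * exp (- a * t\<^sup>2)"

text \<open>Termwise integration of the kernel series: the Gamma values cancel and the exponential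
  series of -x^2/(4a) remains.\<close>

lemma gaussian_hankel_kernel_integral:
  assumes "\<alpha> > -1" "a > 0" "x > 0"
  shows "(LINT t|halfline. hankel_gaussian \<alpha> a t * hankel_kernel \<alpha> (x * t))
    = (2 * a) powr (- \<alpha> - 1) * hankel_gaussian \<alpha> (1 / (4 * a)) x"
proof -
  define C where "C = 2 powr (- \<alpha>) * x powr (\<alpha> + 1 / 2)"
  define f where "f k t = C * bessel_coeff \<alpha> k * (x\<^sup>2 / 4) ^ k *
      (t powr (2 * (\<alpha> + real k + 1) - 1) * exp (- a * t\<^sup>2))" for k t
  define c where "c k = (C / (2 * a powr (\<alpha> + 1))) * (bessel_coeff \<alpha> k * Gamma (\<alpha> + real k + 1) * (x\<^sup>2 / (4 * a)) ^ k)" for k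
  have int: "has_bochner_integral halfline (f k) (c k)" for k
  proof -
    have "has_bochner_integral halfline (f k) (C * bessel_coeff \<alpha> k * (x\<^sup>2 / 4) ^ k *
       (Gamma (\<alpha> + real k + 1) / (2 * a powr (\<alpha> + real k + 1))))"
      unfolding f_def[abs_def] using assms
      by (intro has_bochner_integral_mult_right has_bochner_integral_halfline_gaussian_powr) auto
    also have "a powr (\<alpha> + real k + 1) = a powr (\<alpha> + 1) * a ^ k"
      using assms powr_add[of a "\<alpha> + 1" "real k"] by (simp add: powr_realpow add_ac)
    finally show ?thesis
      unfolding c_def by (simp add: power_divide power_mult_distrib mult_ac)
  qed
  \<comment> \<open>Each \<open>f k\<close> has constant sign in \<open>t\<close>, that of the
    coefficient. The integral of its norm is therefore the absolute value of its integral, and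
    absolute convergence of the exponential series justifies exchanging sum and integral.\<close>
  have absint: "integral\<^sup>L halfline (\<lambda>t. norm (f k t)) = \<bar>c k\<bar>" for k
  proof -
    define s where "s = sgn (bessel_coeff \<alpha> k)"
    have "norm (f k t) = s * f k t" for t
    proof -
      define R where "R = C * (x\<^sup>2 / 4) ^ k * (t powr (2 * (\<alpha> + real k + 1) - 1) * exp (- a * t\<^sup>2))"
      have "f k t = bessel_coeff \<alpha> k * R"
        by (simp add: f_def R_def)
      moreover have "R \<ge> 0" by (simp add: R_def C_def)
      ultimately show ?thesis
        by (simp add: abs_mult s_def sgn_if)
    qed
    then have 1: "integral\<^sup>L halfline (\<lambda>t. norm (f k t)) = s * c k"
      using int[of k] by (simp add: has_bochner_integral_iff)
    have "s * c k \<ge> 0" unfolding 1[symmetric] by simp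
    moreover have "s = 1 \<or> s = - 1 \<or> (s = 0 \<and> c k = 0)"
      by (simp add: s_def sgn_if c_def)
    ultimately show ?thesis
      unfolding 1 by (elim disjE conjE) simp_all
  qed
  have c_eq: "c k = (C / (2 * a powr (\<alpha> + 1))) * ((- (x\<^sup>2 / (4 * a))) ^ k /\<^sub>R fact k)" for k
  proof -
    define G where "G = Gamma (\<alpha> + real k + 1)"
    have "G > 0" unfolding G_def using assms by (intro Gamma_real_pos) auto
    then have "bessel_coeff \<alpha> k * Gamma (\<alpha> + real k + 1) = (-1) ^ k / fact k"
      unfolding bessel_coeff_def G_def[symmetric] by simp
    moreover have "(- (x\<^sup>2 / (4 * a))) ^ k /\<^sub>R fact k = (-1) ^ k / fact k * (x\<^sup>2 / (4 * a)) ^ k"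
      by (subst power_minus) (simp only: real_scaleR_def divide_inverse mult_ac)
    ultimately show ?thesis unfolding c_def by (simp only:)
  qed
  have c_sums: "c sums ((C / (2 * a powr (\<alpha> + 1))) * exp (- (x\<^sup>2 / (4 * a))))"
    unfolding c_eq[abs_def] by (intro sums_mult exp_converges)
  have c_abs: "summable (\<lambda>k. \<bar>c k\<bar>)"
    unfolding c_eq[abs_def] real_norm_def[symmetric] norm_mult
    by (intro summable_mult summable_norm_exp)
  have f_sums: "(\<lambda>k. f k t) sums (hankel_gaussian \<alpha> a t * hankel_kernel \<alpha> (x * t))"
    and f_abs: "summable (\<lambda>k. norm (f k t))" if "t > 0" for t
  proof -
    define D where "D = C * (t powr (2 * \<alpha> + 1) * exp (- a * t\<^sup>2))"
    have t: "f k t = D * (bessel_coeff \<alpha> k * ((x * t)\<^sup>2 / 4) ^ k)" for k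
    proof -
      have "t powr (2 * (\<alpha> + real k + 1) - 1) = t powr (2 * \<alpha> + 1) * t powr real (2 * k)"
        by (simp flip: powr_add add: algebra_simps)
      also have "t powr real (2 * k) = (t\<^sup>2) ^ k"
        using that by (subst powr_realpow) (auto simp: power_mult)
      finally show ?thesis
        unfolding f_def D_def by (simp add: power_mult_distrib power_divide mult_ac)
    qed
    have "summable (\<lambda>k. bessel_coeff \<alpha> k * ((x * t)\<^sup>2 / 4) ^ k)"
      using assms by (intro summable_bessel_coeff)
    then have "(\<lambda>k. f k t) sums (D * bessel_entire \<alpha> ((x * t)\<^sup>2 / 4))"
      unfolding t bessel_entire_def by (intro sums_mult summable_sums)
    moreover have "D * bessel_entire \<alpha> ((x * t)\<^sup>2 / 4)
        = hankel_gaussian \<alpha> a t * hankel_kernel \<alpha> (x * t)"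
    proof -
      have "t powr (2 * \<alpha> + 1) = t powr (\<alpha> + 1 / 2) * t powr (\<alpha> + 1 / 2)"
        by (simp flip: powr_add add: algebra_simps)
      then show ?thesis
        using assms that
        by (simp add: D_def C_def hankel_gaussian_def hankel_kernel_eq powr_mult mult_ac)
    qed
    ultimately show "(\<lambda>k. f k t) sums (hankel_gaussian \<alpha> a t * hankel_kernel \<alpha> (x * t))"
      by simp
    \<comment> \<open>Convergence at the larger argument \<open>(x * t)\<^sup>2 / 4 + 1\<close>
      gives absolute convergence at the one wanted.\<close>
    have "summable (\<lambda>k. norm (bessel_coeff \<alpha> k * ((x * t)\<^sup>2 / 4) ^ k))"
      using assms(1) powser_insidea[of "bessel_coeff \<alpha>" "(x * t)\<^sup>2 / 4 + 1" "(x * t)\<^sup>2 / 4"]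
      by (auto intro!: summable_bessel_coeff)
    then show "summable (\<lambda>k. norm (f k t))"
      unfolding t norm_mult[of D] by (rule summable_mult)
  qed
  have "(LINT t|halfline. hankel_gaussian \<alpha> a t * hankel_kernel \<alpha> (x * t))
      = (LINT t|halfline. (\<Sum>k. f k t))"
    using f_sums by (intro Bochner_Integration.integral_cong) (auto simp: sums_iff)
  also have "\<dots> = (\<Sum>k. integral\<^sup>L halfline (f k))"
    using int f_abs c_abs absint
    by (intro integral_suminf) (auto simp: has_bochner_integral_iff intro!: AE_I2)
  also have "\<dots> = (\<Sum>k. c k)"
    using int by (simp add: has_bochner_integral_iff)
  also have "\<dots> = (C / (2 * a powr (\<alpha> + 1))) * exp (- (x\<^sup>2 / (4 * a)))"
    using c_sums by (simp add: sums_iff)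
  also have "C / (2 * a powr (\<alpha> + 1)) = (2 * a) powr (- \<alpha> - 1) * x powr (\<alpha> + 1 / 2)"
  proof -
    have "2 powr (- \<alpha> - 1) = 2 powr (- \<alpha>) / (2::real)"
      by (simp only: powr_diff powr_one)
    moreover have "a powr (- \<alpha> - 1) = 1 / a powr (\<alpha> + 1)"
      using powr_minus_divide[of a "\<alpha> + 1"] by simp
    ultimately have "(2 * a) powr (- \<alpha> - 1) = 2 powr (- \<alpha>) / 2 * (1 / a powr (\<alpha> + 1))"
      using assms by (simp only: powr_mult)
    then show ?thesis by (simp add: C_def)
  qed
  finally show ?thesis
    by (simp add: hankel_gaussian_def)
qed

subsection \<open>Functions on which the transform is involutive\<close>

definition L2_sq :: "(real \<Rightarrow> complex) \<Rightarrow> real" where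
  "L2_sq f = (LINT t|halfline. (cmod (f t))\<^sup>2)"

section \<open>Arithmetic of squared norms\<close>

lemma L2_norm_power2: "(L2_norm f)\<^sup>2 = L2_sq f"
  by (simp add: L2_norm_def L2_sq_def)

lemma L2_sq_nonneg: "L2_sq f \<ge> 0"
  by (simp add: L2_sq_def)

lemma L2_sq_cong: "(\<And>x. x > 0 \<Longrightarrow> f x = g x) \<Longrightarrow> L2_sq f = L2_sq g"
  unfolding L2_sq_def by (intro Bochner_Integration.integral_cong) auto

lemma L2_halflineD:
  assumes "f \<in> L2_halfline"
  shows "f \<in> borel_measurable halfline" "integrable halfline (\<lambda>t. (cmod (f t))\<^sup>2)"
  using assms by (auto simp: L2_halfline_def)

lemma cmod_add_power2_le: "(cmod (a + b))\<^sup>2 \<le> 2 * (cmod a)\<^sup>2 + 2 * (cmod b)\<^sup>2"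
proof -
  have "(cmod (a + b))\<^sup>2 \<le> (cmod a + cmod b)\<^sup>2"
    by (intro power_mono norm_triangle_ineq norm_ge_zero)
  also have "\<dots> \<le> 2 * (cmod a)\<^sup>2 + 2 * (cmod b)\<^sup>2"
    using sum_squares_bound[of "cmod a" "cmod b"] by (simp add: power2_sum)
  finally show ?thesis .
qed

lemma L2_halfline_add:
  assumes "f \<in> L2_halfline" "g \<in> L2_halfline"
  shows "(\<lambda>x. f x + g x) \<in> L2_halfline"
    and "L2_sq (\<lambda>x. f x + g x) \<le> 2 * L2_sq f + 2 * L2_sq g"
proof -
  note [measurable] = L2_halflineD(1)[OF assms(1)] L2_halflineD(1)[OF assms(2)]
  have i: "integrable halfline (\<lambda>t. 2 * (cmod (f t))\<^sup>2 + 2 * (cmod (g t))\<^sup>2)"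
    using L2_halflineD(2)[OF assms(1)] L2_halflineD(2)[OF assms(2)] by simp
  have j: "integrable halfline (\<lambda>t. (cmod (f t + g t))\<^sup>2)"
    by (rule Bochner_Integration.integrable_bound[OF i])
       (auto intro!: AE_I2 order_trans[OF cmod_add_power2_le])
  then show "(\<lambda>x. f x + g x) \<in> L2_halfline"
    by (simp add: L2_halfline_def)
  have "L2_sq (\<lambda>x. f x + g x) \<le> (LINT t|halfline. 2 * (cmod (f t))\<^sup>2 + 2 * (cmod (g t))\<^sup>2)"
    unfolding L2_sq_def by (intro integral_mono i j cmod_add_power2_le)
  also have "\<dots> = 2 * L2_sq f + 2 * L2_sq g"
    using L2_halflineD(2)[OF assms(1)] L2_halflineD(2)[OF assms(2)] by (simp add: L2_sq_def)
  finally show "L2_sq (\<lambda>x. f x + g x) \<le> 2 * L2_sq f + 2 * L2_sq g" .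
qed

lemma L2_halfline_cmult:
  assumes "f \<in> L2_halfline"
  shows "(\<lambda>x. c * f x) \<in> L2_halfline" and "L2_sq (\<lambda>x. c * f x) = (cmod c)\<^sup>2 * L2_sq f"
  using assms by (auto simp: L2_halfline_def L2_sq_def norm_mult power_mult_distrib)

lemma L2_halfline_diff:
  assumes "f \<in> L2_halfline" "g \<in> L2_halfline"
  shows "(\<lambda>x. f x - g x) \<in> L2_halfline"
    and "L2_sq (\<lambda>x. f x - g x) \<le> 2 * L2_sq f + 2 * L2_sq g"
  using L2_halfline_add[OF assms(1) L2_halfline_cmult(1)[OF assms(2), of "-1"]]
    L2_halfline_cmult(2)[OF assms(2), of "-1"] by auto

lemma L2_sq_triangle:
  assumes "f \<in> L2_halfline" "g \<in> L2_halfline" "h \<in> L2_halfline"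
  shows "L2_sq (\<lambda>x. f x - h x) \<le> 2 * L2_sq (\<lambda>x. f x - g x) + 2 * L2_sq (\<lambda>x. g x - h x)"
  using L2_halfline_add(2)[OF L2_halfline_diff(1)[OF assms(1,2)] L2_halfline_diff(1)[OF assms(2,3)]]
  by simp

lemma L2_sq_diff_commute: "L2_sq (\<lambda>x. f x - g x) = L2_sq (\<lambda>x. g x - f x)"
  by (simp add: L2_sq_def norm_minus_commute)

lemma L2_sq_le_diff:
  assumes "f \<in> L2_halfline" "g \<in> L2_halfline"
  shows "L2_sq f \<le> 2 * L2_sq (\<lambda>x. f x - g x) + 2 * L2_sq g"
  using L2_halfline_add(2)[OF L2_halfline_diff(1)[OF assms] assms(2)] by simp

lemma hankel_kernel_measurable [measurable]: "hankel_kernel \<alpha> \<in> borel_measurable borel"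
  unfolding hankel_kernel_def bessel_J_def by measurable

section \<open>The integral transform of integrable functions\<close>

lemma hankel_integral_kernel:
  "hankel_integral \<alpha> f x = (LINT t|halfline. f t * of_real (hankel_kernel \<alpha> (x * t)))"
  by (simp add: hankel_integral_def hankel_kernel_def)

lemma hankel_integral_cong:
  "(\<And>t. t > 0 \<Longrightarrow> f t = g t) \<Longrightarrow> hankel_integral \<alpha> f x = hankel_integral \<alpha> g x"
  unfolding hankel_integral_kernel by (intro Bochner_Integration.integral_cong) auto

lemma hankel_integral_integrable:
  fixes f :: "real \<Rightarrow> complex"
  assumes "\<alpha> > - 1 / 2" "integrable halfline f" "x > 0"
  shows "integrable halfline (\<lambda>t. f t * of_real (hankel_kernel \<alpha> (x * t)))"
proof -
  obtain M where M: "M > 0" "\<And>y. y > 0 \<Longrightarrow> \<bar>hankel_kernel \<alpha> y\<bar> \<le> M"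
    using hankel_kernel_bounded[OF assms(1)] by blast
  note [measurable] = borel_measurable_integrable[OF assms(2)]
  show ?thesis
  proof (rule Bochner_Integration.integrable_bound)
    show "integrable halfline (\<lambda>t. of_real M * f t)" using assms by simp
    show "AE t in halfline. norm (f t * of_real (hankel_kernel \<alpha> (x * t))) \<le> norm (of_real M * f t)"
      using M assms(3) by (intro AE_I2) (simp add: norm_mult mult_left_mono mult.commute[of M "norm _"])
  qed measurable
qed

text \<open>\<open>M\<close> is uniform in the function and the point, so approximation in
  \<open>L^1\<close> carries over to pointwise convergence of transforms.\<close>

lemma hankel_integral_bounded:
  assumes "\<alpha> > - 1 / 2"
  obtains M where "M > 0"
    "\<And>f x. integrable halfline f \<Longrightarrow> x > 0 \<Longrightarrow>
      cmod (hankel_integral \<alpha> f x) \<le> M * (LINT t|halfline. cmod (f t))"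
proof -
  obtain M where M: "M > 0" "\<And>y. y > 0 \<Longrightarrow> \<bar>hankel_kernel \<alpha> y\<bar> \<le> M"
    using hankel_kernel_bounded[OF assms(1)] by blast
  show thesis
  proof (rule that[OF M(1)])
    fix f :: "real \<Rightarrow> complex" and x :: real assume f: "integrable halfline f" and x: "x > 0"
    have "cmod (hankel_integral \<alpha> f x) \<le> (LINT t|halfline. cmod (f t * of_real (hankel_kernel \<alpha> (x * t))))"
      unfolding hankel_integral_kernel by (rule integral_norm_bound)
    also have "\<dots> \<le> (LINT t|halfline. M * cmod (f t))"
    proof (rule integral_mono)
      show "integrable halfline (\<lambda>t. cmod (f t * of_real (hankel_kernel \<alpha> (x * t))))"
        using hankel_integral_integrable[OF assms f x] by (rule integrable_norm)
      show "cmod (f t * of_real (hankel_kernel \<alpha> (x * t))) \<le> M * cmod (f t)" if "t \<in> space halfline" for t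
        using M(2)[of "x * t"] x that by (simp add: norm_mult mult_left_mono mult.commute[of M "norm _"])
    qed (use f in simp)
    also have "\<dots> = M * (LINT t|halfline. cmod (f t))" by simp
    finally show "cmod (hankel_integral \<alpha> f x) \<le> M * (LINT t|halfline. cmod (f t))" .
  qed
qed

lemma hankel_integral_measurable:
  assumes [measurable]: "f \<in> borel_measurable halfline"
  shows "hankel_integral \<alpha> f \<in> borel_measurable halfline"
  unfolding hankel_integral_kernel[abs_def] by measurable

lemma hankel_integral_lincomb:
  assumes "\<alpha> > - 1 / 2" "integrable halfline f" "integrable halfline g" "x > 0"
  shows "hankel_integral \<alpha> (\<lambda>t. a * f t + b * g t) x =
    a * hankel_integral \<alpha> f x + b * hankel_integral \<alpha> g x"
  using hankel_integral_integrable[OF assms(1,2,4)] hankel_integral_integrable[OF assms(1,3,4)]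
  unfolding hankel_integral_kernel by (simp add: ring_distribs mult.assoc)

lemma hankel_integral_diff:
  assumes "\<alpha> > - 1 / 2" "integrable halfline f" "integrable halfline g" "x > 0"
  shows "hankel_integral \<alpha> (\<lambda>t. f t - g t) x = hankel_integral \<alpha> f x - hankel_integral \<alpha> g x"
  using hankel_integral_lincomb[OF assms, of 1 "-1"] by simp

lemma hankel_integral_cnj:
  "hankel_integral \<alpha> (\<lambda>t. cnj (f t)) x = cnj (hankel_integral \<alpha> f x)"
  unfolding hankel_integral_kernel by (subst Bochner_Integration.integral_cnj[symmetric]) simp

text \<open>The kernel depends on x t only and is thus symmetric; being bounded by \<open>M\<close>,
  it leaves a double integrand dominated by a product of integrable functions, and Fubini
  applies.\<close>

lemma hankel_integral_multiplication_formula: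
  assumes "\<alpha> > - 1 / 2" "integrable halfline f" "integrable halfline g"
  shows "(LINT x|halfline. hankel_integral \<alpha> f x * g x) = (LINT t|halfline. f t * hankel_integral \<alpha> g t)"
proof -
  obtain M where M: "M > 0" "\<And>y. y > 0 \<Longrightarrow> \<bar>hankel_kernel \<alpha> y\<bar> \<le> M"
    using hankel_kernel_bounded[OF assms(1)] by blast
  note [measurable] = borel_measurable_integrable[OF assms(2)] borel_measurable_integrable[OF assms(3)]
  define K where "K = (\<lambda>x t. f t * of_real (hankel_kernel \<alpha> (x * t)) * g x)"
  have "integrable (halfline \<Otimes>\<^sub>M halfline) (\<lambda>(x, t). M * (norm (g x) * norm (f t)))"
    using assms by (intro halfline_pair.Fubini_integrable) (auto simp: abs_mult)
  then have "integrable (halfline \<Otimes>\<^sub>M halfline) (\<lambda>(x, t). K x t)"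
  proof (rule Bochner_Integration.integrable_bound)
    have "norm (K x t) \<le> M * (norm (g x) * norm (f t))" if "x > 0" "t > 0" for x t
    proof -
      have "norm (K x t) = \<bar>hankel_kernel \<alpha> (x * t)\<bar> * (norm (g x) * norm (f t))"
        by (simp add: K_def norm_mult mult_ac)
      also have "\<dots> \<le> M * (norm (g x) * norm (f t))"
        using M that by (intro mult_right_mono) auto
      finally show ?thesis .
    qed
    then show "AE p in halfline \<Otimes>\<^sub>M halfline. norm (case p of (x, t) \<Rightarrow> K x t)
        \<le> norm (case p of (x, t) \<Rightarrow> M * (norm (g x) * norm (f t)))"
      using M(1) by (intro AE_I2) (auto simp: space_pair_measure abs_mult)
  qed (simp add: K_def)
  then have "(LINT t|halfline. LINT x|halfline. K x t) = (LINT x|halfline. LINT t|halfline. K x t)"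
    by (rule halfline_pair.Fubini_integral)
  moreover have "(LINT t|halfline. K x t) = hankel_integral \<alpha> f x * g x" for x
    by (simp add: K_def hankel_integral_kernel)
  moreover have "(LINT x|halfline. K x t) = f t * hankel_integral \<alpha> g t" for t
    by (simp add: K_def hankel_integral_kernel mult_ac)
  ultimately show ?thesis by simp
qed

text \<open>Integrability of the transform makes the second application an honest integral, and
  involution is demanded at every positive point. The class is closed under linear combinations,
  which is all that the density argument needs.\<close>

definition hankel_nice :: "real \<Rightarrow> (real \<Rightarrow> complex) \<Rightarrow> bool" where
  "hankel_nice \<alpha> f \<longleftrightarrow> integrable halfline f \<and> f \<in> L2_halfline \<and>
     integrable halfline (hankel_integral \<alpha> f) \<and> hankel_integral \<alpha> f \<in> L2_halfline \<and>
     (\<forall>x>0. hankel_integral \<alpha> (hankel_integral \<alpha> f) x = f x)"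

lemma integrable_halfline_cong:
  "(\<And>x. x > 0 \<Longrightarrow> f x = g x) \<Longrightarrow> integrable halfline f \<longleftrightarrow> integrable halfline g"
  by (intro Bochner_Integration.integrable_cong) auto

lemma L2_halfline_cong:
  "(\<And>x. x > 0 \<Longrightarrow> f x = g x) \<Longrightarrow> f \<in> L2_halfline \<longleftrightarrow> g \<in> L2_halfline"
  unfolding L2_halfline_def mem_Collect_eq
  by (intro conj_cong measurable_cong Bochner_Integration.integrable_cong) auto

lemma hankel_nice_lincomb:
  assumes "\<alpha> > - 1 / 2" "hankel_nice \<alpha> f" "hankel_nice \<alpha> g"
  shows "hankel_nice \<alpha> (\<lambda>x. a * f x + b * g x)"
proof -
  have i: "integrable halfline f" "integrable halfline g" "f \<in> L2_halfline" "g \<in> L2_halfline"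
    and j: "integrable halfline (hankel_integral \<alpha> f)" "integrable halfline (hankel_integral \<alpha> g)"
      "hankel_integral \<alpha> f \<in> L2_halfline" "hankel_integral \<alpha> g \<in> L2_halfline"
    using assms by (auto simp: hankel_nice_def)
  let ?h = "\<lambda>x. a * hankel_integral \<alpha> f x + b * hankel_integral \<alpha> g x"
  have H: "hankel_integral \<alpha> (\<lambda>x. a * f x + b * g x) x = ?h x" if "x > 0" for x
    using hankel_integral_lincomb[OF assms(1) i(1,2) that] .
  have HH: "hankel_integral \<alpha> (hankel_integral \<alpha> (\<lambda>x. a * f x + b * g x)) x = a * f x + b * g x"
    if "x > 0" for x
  proof -
    have "hankel_integral \<alpha> (hankel_integral \<alpha> (\<lambda>x. a * f x + b * g x)) x = hankel_integral \<alpha> ?h x"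
      using H by (rule hankel_integral_cong)
    also have "\<dots> = a * f x + b * g x"
      using hankel_integral_lincomb[OF assms(1) j(1,2) that] assms(2,3) that
      by (simp add: hankel_nice_def)
    finally show ?thesis .
  qed
  have "integrable halfline (hankel_integral \<alpha> (\<lambda>x. a * f x + b * g x))"
    using j by (subst integrable_halfline_cong[OF H]) auto
  moreover have "hankel_integral \<alpha> (\<lambda>x. a * f x + b * g x) \<in> L2_halfline"
    using j by (subst L2_halfline_cong[OF H]) (auto intro: L2_halfline_add L2_halfline_cmult)
  ultimately show ?thesis
    using i HH unfolding hankel_nice_def by (auto intro: L2_halfline_add L2_halfline_cmult)
qed

text \<open>The kernel is real, so H commutes with conjugation. Moving H across the product Hf * cnj
  (Hf) by the multiplication formula leaves f * cnj (H (H f)), which is f * cnj f.\<close>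

lemma hankel_nice_isometry:
  assumes "\<alpha> > - 1 / 2" "hankel_nice \<alpha> f"
  shows "L2_sq (hankel_integral \<alpha> f) = L2_sq f"
proof -
  let ?H = "hankel_integral \<alpha>"
  have i: "integrable halfline f" "integrable halfline (\<lambda>x. cnj (?H f x))"
    using assms by (auto simp: hankel_nice_def)
  have "complex_of_real (L2_sq (?H f)) = (LINT x|halfline. ?H f x * cnj (?H f x))"
    by (simp add: L2_sq_def complex_norm_square[symmetric] del: of_real_power)
  also have "\<dots> = (LINT x|halfline. f x * ?H (\<lambda>x. cnj (?H f x)) x)"
    using i assms(1) by (intro hankel_integral_multiplication_formula) auto
  also have "\<dots> = (LINT x|halfline. f x * cnj (f x))"
    using assms(2) by (intro Bochner_Integration.integral_cong) (auto simp: hankel_integral_cnj hankel_nice_def)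
  also have "\<dots> = complex_of_real (L2_sq f)"
    by (simp add: L2_sq_def complex_norm_square[symmetric] del: of_real_power)
  finally show ?thesis by (simp only: of_real_eq_iff)
qed

lemma hankel_gaussian_L1_L2:
  assumes "\<alpha> > - 1" "a > 0"
  shows "integrable halfline (\<lambda>t. complex_of_real (hankel_gaussian \<alpha> a t))"
    and "(\<lambda>t. complex_of_real (hankel_gaussian \<alpha> a t)) \<in> L2_halfline"
proof -
  have [measurable]: "hankel_gaussian \<alpha> a \<in> borel_measurable halfline"
    unfolding hankel_gaussian_def[abs_def] by measurable
  \<comment> \<open>The parameter b = (\<alpha> + 3/2)/2 solves 2 b - 1 = \<alpha> + 1/2. For the
    square below, the exponent and the rate double, so b = \<alpha> + 1 and the rate is 2 a.\<close>
  have "integrable halfline (\<lambda>t. t powr (2 * ((\<alpha> + 3 / 2) / 2) - 1) * exp (- a * t\<^sup>2))"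
    using has_bochner_integral_halfline_gaussian_powr[of a "(\<alpha> + 3 / 2) / 2"] assms
    by (auto simp only: has_bochner_integral_iff) auto
  moreover have "2 * ((\<alpha> + 3 / 2) / 2) - 1 = \<alpha> + 1 / 2" by (simp add: field_simps)
  ultimately show "integrable halfline (\<lambda>t. complex_of_real (hankel_gaussian \<alpha> a t))"
    by (simp only: hankel_gaussian_def of_real_eq_iff) (simp only: complex_of_real_integrable_eq)
  have "integrable halfline (\<lambda>t. t powr (2 * (\<alpha> + 1) - 1) * exp (- (2 * a) * t\<^sup>2))"
    using has_bochner_integral_halfline_gaussian_powr[of "2 * a" "\<alpha> + 1"] assms
    by (auto simp: has_bochner_integral_iff)
  moreover have "t powr (2 * (\<alpha> + 1) - 1) * exp (- (2 * a) * t\<^sup>2) = (hankel_gaussian \<alpha> a t)\<^sup>2" for t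
  proof -
    have "t powr (2 * (\<alpha> + 1) - 1) = t powr (\<alpha> + 1 / 2) * t powr (\<alpha> + 1 / 2)"
      by (simp flip: powr_add add: algebra_simps)
    moreover have "exp (- (2 * a) * t\<^sup>2) = exp (- a * t\<^sup>2) * exp (- a * t\<^sup>2)"
      by (simp flip: exp_add)
    ultimately show ?thesis
      by (simp only: hankel_gaussian_def power2_eq_square mult_ac)
  qed
  ultimately show "(\<lambda>t. complex_of_real (hankel_gaussian \<alpha> a t)) \<in> L2_halfline"
    by (simp add: L2_halfline_def)
qed

lemma hankel_integral_gaussian:
  assumes "\<alpha> > - 1" "a > 0" "x > 0"
  shows "hankel_integral \<alpha> (\<lambda>t. of_real (hankel_gaussian \<alpha> a t)) x
    = of_real ((2 * a) powr (- \<alpha> - 1)) * of_real (hankel_gaussian \<alpha> (1 / (4 * a)) x)"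
  unfolding hankel_integral_kernel of_real_mult[symmetric] integral_complex_of_real
  using gaussian_hankel_kernel_integral[OF assms] by simp

text \<open>The parameter change from a to 1/(4a) is an involution, and the two prefactors, powers
  of 2a and 1/(2a) with the same exponent, multiply to 1.\<close>

lemma hankel_nice_gaussian:
  assumes "\<alpha> > - 1 / 2" "a > 0"
  shows "hankel_nice \<alpha> (\<lambda>t. of_real (hankel_gaussian \<alpha> a t))"
proof -
  let ?f = "\<lambda>a t. complex_of_real (hankel_gaussian \<alpha> a t)"
  let ?c = "complex_of_real ((2 * a) powr (- \<alpha> - 1))"
  have f: "integrable halfline (?f b)" "?f b \<in> L2_halfline" if "b > 0" for b
    using hankel_gaussian_L1_L2[of \<alpha> b] assms that by auto
  have H: "hankel_integral \<alpha> (?f a) x = ?c * ?f (1 / (4 * a)) x" if "x > 0" for x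
    using hankel_integral_gaussian[of \<alpha> a x] assms that by simp
  have "hankel_integral \<alpha> (hankel_integral \<alpha> (?f a)) x = ?f a x" if "x > 0" for x
  proof -
    have "hankel_integral \<alpha> (hankel_integral \<alpha> (?f a)) x = hankel_integral \<alpha> (\<lambda>x. ?c * ?f (1 / (4 * a)) x) x"
      using H by (rule hankel_integral_cong)
    also have "\<dots> = ?c * hankel_integral \<alpha> (?f (1 / (4 * a))) x"
      using hankel_integral_lincomb[OF assms(1) f(1) f(1) that, of "1 / (4 * a)" "1 / (4 * a)" ?c 0] assms
      by simp
    also have "hankel_integral \<alpha> (?f (1 / (4 * a))) x =
        of_real ((2 * (1 / (4 * a))) powr (- \<alpha> - 1)) * ?f (1 / (4 * (1 / (4 * a)))) x"
      using assms that by (intro hankel_integral_gaussian) auto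
    also have "1 / (4 * (1 / (4 * a))) = a" by simp
    also have "?c * (of_real ((2 * (1 / (4 * a))) powr (- \<alpha> - 1)) * ?f a x) =
        of_real ((2 * a) powr (- \<alpha> - 1) * (2 * (1 / (4 * a))) powr (- \<alpha> - 1)) * ?f a x"
      by simp
    also have "(2 * a) powr (- \<alpha> - 1) * (2 * (1 / (4 * a))) powr (- \<alpha> - 1)
        = (2 * a * (2 * (1 / (4 * a)))) powr (- \<alpha> - 1)"
      using assms by (intro powr_mult[symmetric])
    also have "2 * a * (2 * (1 / (4 * a))) = 1" using assms by simp
    finally show ?thesis by simp
  qed
  moreover have "integrable halfline (hankel_integral \<alpha> (?f a))"
    using f[of "1 / (4 * a)"] assms by (subst integrable_halfline_cong[OF H]) auto
  moreover have "hankel_integral \<alpha> (?f a) \<in> L2_halfline"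
    using f[of "1 / (4 * a)"] assms by (subst L2_halfline_cong[OF H]) (auto intro: L2_halfline_cmult)
  ultimately show ?thesis
    using f[of a] assms unfolding hankel_nice_def by auto
qed

subsection \<open>Density in \<open>L\<^sup>1 \<inter> L\<^sup>2\<close>\<close>

lemma hankel_nice_sum:
  assumes "\<alpha> > - 1 / 2" "\<And>i. hankel_nice \<alpha> (f i)"
  shows "hankel_nice \<alpha> (\<lambda>x. \<Sum>i\<le>n::nat. c i * f i x)"
proof (induction n)
  case 0
  show ?case using hankel_nice_lincomb[OF assms(1) assms(2) assms(2), of "c 0" 0 0] by simp
next
  case (Suc n)
  show ?case using hankel_nice_lincomb[OF assms(1) Suc assms(2), of 1 "c (Suc n)" "Suc n"] by simp
qed

text \<open>Each factor exp(-x^2) raises the rate of the Gaussian by 1, so the product is a linear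
  combination of the functions with rates 1 + i.\<close>

lemma hankel_nice_gaussian_real_polynomial:
  assumes "\<alpha> > - 1 / 2" "real_polynomial_function p"
  shows "hankel_nice \<alpha> (\<lambda>x. of_real (hankel_gaussian \<alpha> 1 x * p (exp (- x\<^sup>2))))"
proof -
  obtain a n where p: "p = (\<lambda>x. \<Sum>i\<le>n. a i * x ^ i)"
    using assms(2) real_polynomial_function_iff_sum by auto
  have "hankel_gaussian \<alpha> (1 + real i) x = hankel_gaussian \<alpha> 1 x * exp (- x\<^sup>2) ^ i" for i x
  proof -
    have "exp (- (1 + real i) * x\<^sup>2) = exp (- 1 * x\<^sup>2) * exp (real i * (- x\<^sup>2))"
      by (simp flip: exp_add add: algebra_simps)
    then show ?thesis
      by (simp only: hankel_gaussian_def exp_of_nat_mult mult.assoc)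
  qed
  then have "(\<Sum>i\<le>n. of_real (a i) * of_real (hankel_gaussian \<alpha> (1 + real i) x))
     = complex_of_real (hankel_gaussian \<alpha> 1 x * p (exp (- x\<^sup>2)))" for x
    by (simp add: p sum_distrib_left mult_ac)
  then show ?thesis
    using hankel_nice_sum[of \<alpha> "\<lambda>i x. of_real (hankel_gaussian \<alpha> (1 + real i) x)" "\<lambda>i. of_real (a i)" n,
      OF assms(1) hankel_nice_gaussian] assms(1) by simp
qed

lemma hankel_nice_gaussian_polynomial:
  fixes p :: "real \<Rightarrow> complex"
  assumes "\<alpha> > - 1 / 2" "polynomial_function p"
  shows "hankel_nice \<alpha> (\<lambda>x. of_real (hankel_gaussian \<alpha> 1 x) * p (exp (- x\<^sup>2)))"
proof -
  have "real_polynomial_function (\<lambda>x. Re (p x))" "real_polynomial_function (\<lambda>x. Im (p x))"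
    using assms(2) bounded_linear_Re bounded_linear_Im
    unfolding polynomial_function_def by (auto simp: o_def)
  then have "hankel_nice \<alpha> (\<lambda>x. 1 * of_real (hankel_gaussian \<alpha> 1 x * Re (p (exp (- x\<^sup>2)))) +
      \<i> * of_real (hankel_gaussian \<alpha> 1 x * Im (p (exp (- x\<^sup>2)))))"
    by (intro hankel_nice_lincomb assms(1) hankel_nice_gaussian_real_polynomial)
  moreover have "1 * of_real (hankel_gaussian \<alpha> 1 x * Re (p (exp (- x\<^sup>2)))) +
      \<i> * of_real (hankel_gaussian \<alpha> 1 x * Im (p (exp (- x\<^sup>2))))
     = of_real (hankel_gaussian \<alpha> 1 x) * p (exp (- x\<^sup>2))" for x
    by (simp add: complex_eq_iff)
  ultimately show ?thesis by simp
qed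

text \<open>The variable y = exp(-x^2) maps the half-line into [0, 1], where polynomials are dense.
  Approximating c/w instead of c, with w the Gaussian of rate 1, leaves an error weighted by w,
  which lies in both \<open>L^1\<close> and \<open>L^2\<close> even though the half-line is
  unbounded.\<close>

lemma hankel_nice_approx_compact_support:
  fixes c :: "real \<Rightarrow> complex"
  assumes "\<alpha> > - 1 / 2" "0 < a" "a < b" "continuous_on UNIV c"
    and c0: "\<And>x. x \<le> a \<or> x \<ge> b \<Longrightarrow> c x = 0" and "e > 0"
  obtains \<phi> where "hankel_nice \<alpha> \<phi>" "\<And>x. x > 0 \<Longrightarrow> cmod (c x - \<phi> x) \<le> e * hankel_gaussian \<alpha> 1 x"
proof -
  define w where "w = hankel_gaussian \<alpha> 1"
  define u v where "u = exp (- b\<^sup>2)" and "v = exp (- a\<^sup>2)"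
  \<comment> \<open>The quotient c/w in the variable y, with x = sqrt(-ln y). The end points
    \<open>u\<close> and \<open>v\<close> correspond to \<open>b\<close> and \<open>a\<close> in
    reversed order.\<close>
  define q where "q y = (if y \<in> {u..v} then c (sqrt (- ln y)) / of_real (w (sqrt (- ln y))) else 0)" for y
  have "a\<^sup>2 < b\<^sup>2" using assms by (intro power_strict_mono) auto
  then have uv: "0 < u" "u < v" "v < 1" using \<open>0 < a\<close> by (auto simp: u_def v_def)
  have r: "sqrt (- ln y) \<in> {a..b}" if "y \<in> {u..v}" for y
  proof -
    have "ln u \<le> ln y" "ln y \<le> ln v"
      using that uv by auto
    then have "- b\<^sup>2 \<le> ln y" "ln y \<le> - a\<^sup>2"
      by (simp_all add: u_def v_def)
    then show ?thesis
      using assms by (auto intro: real_le_rsqrt real_le_lsqrt)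
  qed
  have wpos: "w x > 0" if "x > 0" for x
    using that by (simp add: w_def hankel_gaussian_def)
  \<comment> \<open>Gluing on closed sets: the pieces meet only at \<open>u\<close> and
    \<open>v\<close>, where the quotient is 0 because \<open>c\<close> vanishes at \<open>b\<close>
    and \<open>a\<close>.\<close>
  have "continuous_on ({u..v} \<union> ({0..u} \<union> {v..1})) q"
    unfolding q_def
  proof (rule continuous_on_cases)
    have cr: "continuous_on {u..v} (\<lambda>y. sqrt (- ln y))"
      using uv by (intro continuous_intros) auto
    have cw: "continuous_on {a..b} w"
      unfolding w_def hankel_gaussian_def[abs_def] using \<open>0 < a\<close> by (intro continuous_intros) auto
    have "continuous_on {u..v} (\<lambda>y. w (sqrt (- ln y)))"
      by (rule continuous_on_compose2[OF cw cr]) (use r in blast)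
    moreover have "continuous_on {u..v} (\<lambda>y. c (sqrt (- ln y)))"
      by (rule continuous_on_compose2[OF assms(4) cr]) auto
    moreover have "w (sqrt (- ln y)) \<noteq> 0" if "y \<in> {u..v}" for y
    proof -
      have "sqrt (- ln y) > 0"
        using r[OF that] \<open>0 < a\<close> by (meson atLeastAtMost_iff less_le_trans)
      from wpos[OF this] show ?thesis by (rule less_imp_neq[THEN not_sym])
    qed
    ultimately show "continuous_on {u..v} (\<lambda>y. c (sqrt (- ln y)) / of_real (w (sqrt (- ln y))))"
      by (intro continuous_intros) auto
    show "\<forall>y. y \<in> {u..v} \<and> y \<notin> {u..v} \<or> y \<in> {0..u} \<union> {v..1} \<and> y \<in> {u..v} \<longrightarrow>
        c (sqrt (- ln y)) / of_real (w (sqrt (- ln y))) = 0"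
    proof (intro allI impI)
      fix y assume "y \<in> {u..v} \<and> y \<notin> {u..v} \<or> y \<in> {0..u} \<union> {v..1} \<and> y \<in> {u..v}"
      then have "y = u \<or> y = v" by auto
      then have "sqrt (- ln y) = b \<or> sqrt (- ln y) = a"
        using assms by (auto simp: u_def v_def)
      then show "c (sqrt (- ln y)) / of_real (w (sqrt (- ln y))) = 0"
        using c0 by auto
    qed
  qed auto
  moreover have "{u..v} \<union> ({0..u} \<union> {v..1}) = {0..1}" using uv by auto
  ultimately have "continuous_on {0..1} q" by simp
  then obtain p where p: "polynomial_function p" "\<And>y. y \<in> {0..1} \<Longrightarrow> norm (q y - p y) < e"
    using Stone_Weierstrass_polynomial_function[of "{0..1}" q e] \<open>e > 0\<close> by auto
  show thesis
  proof (rule that)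
    show "hankel_nice \<alpha> (\<lambda>x. of_real (hankel_gaussian \<alpha> 1 x) * p (exp (- x\<^sup>2)))"
      by (rule hankel_nice_gaussian_polynomial[OF assms(1) p(1)])
    fix x :: real assume "x > 0"
    let ?y = "exp (- x\<^sup>2)"
    have "c x = of_real (w x) * q ?y"
    proof (cases "a \<le> x \<and> x \<le> b")
      case True
      then have "?y \<in> {u..v}" using \<open>0 < a\<close> by (auto simp: u_def v_def intro: power_mono)
      then show ?thesis using wpos[of x] \<open>x > 0\<close> by (simp add: q_def)
    next
      case False
      then have "x\<^sup>2 < a\<^sup>2 \<or> b\<^sup>2 < x\<^sup>2"
        using \<open>x > 0\<close> assms by (auto intro: power_strict_mono)
      then have "?y \<notin> {u..v}" by (auto simp: u_def v_def)
      then show ?thesis using c0[of x] False by (auto simp: q_def)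
    qed
    then have "c x - of_real (hankel_gaussian \<alpha> 1 x) * p ?y = of_real (w x) * (q ?y - p ?y)"
      by (simp add: w_def algebra_simps)
    also have "cmod \<dots> \<le> w x * e"
      using wpos[OF \<open>x > 0\<close>] p(2)[of ?y] by (simp add: norm_mult mult_left_mono)
    finally show "cmod (c x - of_real (hankel_gaussian \<alpha> 1 x) * p ?y) \<le> e * hankel_gaussian \<alpha> 1 x"
      by (simp add: w_def mult.commute)
  qed
qed

text \<open>An \<open>L^1\<close> norm plus a squared \<open>L^2\<close> norm. It is no metric, but
  its smallness expresses both kinds of closeness by one number.\<close>

definition L12_dist :: "(real \<Rightarrow> complex) \<Rightarrow> (real \<Rightarrow> complex) \<Rightarrow> real" where
  "L12_dist f g = (LINT t|halfline. cmod (f t - g t)) + L2_sq (\<lambda>t. f t - g t)"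

section \<open>Simultaneous approximation in both norms\<close>

lemma L12_dist_bounds:
  "(LINT t|halfline. cmod (f t - g t)) \<le> L12_dist f g" "L2_sq (\<lambda>t. f t - g t) \<le> L12_dist f g"
  by (auto simp: L12_dist_def L2_sq_nonneg)

lemma L12_dist_triangle:
  assumes "integrable halfline f" "f \<in> L2_halfline" "integrable halfline g" "g \<in> L2_halfline"
    "integrable halfline h" "h \<in> L2_halfline"
  shows "L12_dist f h \<le> 2 * L12_dist f g + 2 * L12_dist g h"
proof -
  have "(LINT t|halfline. cmod (f t - h t)) \<le> (LINT t|halfline. cmod (f t - g t) + cmod (g t - h t))"
    using assms norm_triangle_ineq[of "f t - g t" "g t - h t" for t]
    by (intro integral_mono) auto
  also have "\<dots> = (LINT t|halfline. cmod (f t - g t)) + (LINT t|halfline. cmod (g t - h t))"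
    using assms by (intro Bochner_Integration.integral_add) auto
  also have "\<dots> \<le> 2 * \<dots>" by simp
  finally show ?thesis
    using L2_sq_triangle[OF assms(2,4,6)] by (simp add: L12_dist_def)
qed

lemma L12_dist_dominated_convergence:
  assumes "f \<in> borel_measurable halfline" "\<And>n. s n \<in> borel_measurable halfline"
    and "AE x in halfline. (\<lambda>n. s n x) \<longlonglongrightarrow> f x"
    and "\<And>n x. x > 0 \<Longrightarrow> cmod (f x - s n x) \<le> w x"
    and "integrable halfline w" "integrable halfline (\<lambda>x. (w x)\<^sup>2)"
  shows "(\<lambda>n. L12_dist f (s n)) \<longlonglongrightarrow> 0"
proof -
  note [measurable] = assms(1,2)
  have 0: "AE x in halfline. (\<lambda>n. cmod (f x - s n x)) \<longlonglongrightarrow> 0"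
    using assms(3) by eventually_elim (auto intro!: tendsto_eq_intros)
  then have "(\<lambda>n. LINT t|halfline. cmod (f t - s n t)) \<longlonglongrightarrow> (LINT t|halfline. 0)"
    using assms(4,5)
    by (intro integral_dominated_convergence[where w = w]) (auto intro!: AE_I2)
  moreover have "AE x in halfline. (\<lambda>n. (cmod (f x - s n x))\<^sup>2) \<longlonglongrightarrow> 0"
    using 0 by eventually_elim (auto intro!: tendsto_eq_intros)
  then have "(\<lambda>n. LINT t|halfline. (cmod (f t - s n t))\<^sup>2) \<longlonglongrightarrow> (LINT t|halfline. 0)"
    using assms(4,6)
    by (intro integral_dominated_convergence[where w = "\<lambda>x. (w x)\<^sup>2"])
       (auto intro!: AE_I2 power_mono)
  ultimately show ?thesis
    unfolding L12_dist_def L2_sq_def by (auto intro!: tendsto_eq_intros)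
qed

lemma hankel_nice_approx_continuous:
  fixes c :: "real \<Rightarrow> complex"
  assumes "\<alpha> > - 1 / 2" "0 < a" "a < b" "continuous_on UNIV c"
    and c0: "\<And>x. x \<le> a \<or> x \<ge> b \<Longrightarrow> c x = 0" and "e > 0"
  obtains \<phi> where "hankel_nice \<alpha> \<phi>" "L12_dist c \<phi> < e"
proof -
  let ?w = "hankel_gaussian \<alpha> 1"
  have w0: "?w x \<ge> 0" for x by (simp add: hankel_gaussian_def)
  have "\<forall>n. \<exists>\<phi>. hankel_nice \<alpha> \<phi> \<and> (\<forall>x>0. cmod (c x - \<phi> x) \<le> inverse (real (Suc n)) * ?w x)"
    using hankel_nice_approx_compact_support[OF assms(1-5)]
    by (metis of_nat_0_less_iff positive_imp_inverse_positive zero_less_Suc)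
  then obtain \<phi> where \<phi>: "\<And>n. hankel_nice \<alpha> (\<phi> n)"
    "\<And>n x. x > 0 \<Longrightarrow> cmod (c x - \<phi> n x) \<le> inverse (real (Suc n)) * ?w x"
    by metis
  have w: "integrable halfline ?w" "integrable halfline (\<lambda>x. (?w x)\<^sup>2)"
    using hankel_gaussian_L1_L2[of \<alpha> 1] assms(1)
    by (simp_all add: L2_halfline_def complex_of_real_integrable_eq)
  have "(\<lambda>n. L12_dist c (\<phi> n)) \<longlonglongrightarrow> 0"
  proof (rule L12_dist_dominated_convergence[OF _ _ _ _ w])
    show "c \<in> borel_measurable halfline"
      using assms(4) by (intro measurable_restrict_space1 measurable_completion)
        (simp add: borel_measurable_continuous_onI)
    show "\<phi> n \<in> borel_measurable halfline" for n
      using \<phi>(1)[of n] by (auto simp: hankel_nice_def)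
    show "cmod (c x - \<phi> n x) \<le> ?w x" if "x > 0" for x n
    proof -
      have "inverse (real (Suc n)) * ?w x \<le> 1 * ?w x"
        by (intro mult_right_mono w0) (simp add: field_simps)
      then show ?thesis using \<phi>(2)[OF that, of n] by simp
    qed
    have "(\<lambda>n. \<phi> n x) \<longlonglongrightarrow> c x" if "x > 0" for x
    proof -
      have "(\<lambda>n. inverse (real (Suc n)) * ?w x) \<longlonglongrightarrow> 0"
        using tendsto_mult_right[OF LIMSEQ_inverse_real_of_nat, of "?w x"] by simp
      then have "(\<lambda>n. c x - \<phi> n x) \<longlonglongrightarrow> 0"
        by (rule Lim_null_comparison[rotated]) (use \<phi>(2)[OF that] in auto)
      then show ?thesis
        using Lim_transform2 LIMSEQ_const_iff tendsto_diff[of "\<lambda>_. c x" "c x" sequentially "\<lambda>n. c x - \<phi> n x" 0] by auto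
    qed
    then show "AE x in halfline. (\<lambda>n. \<phi> n x) \<longlonglongrightarrow> c x"
      by (intro AE_I2) auto
  qed
  then have "eventually (\<lambda>n. L12_dist c (\<phi> n) < e) sequentially"
    using \<open>e > 0\<close> by (rule order_tendstoD)
  then obtain n where "L12_dist c (\<phi> n) < e"
    by (auto simp: eventually_sequentially)
  then show thesis using \<phi>(1) that by blast
qed

lemma integrable_halfline_interval:
  "integrable halfline (\<lambda>x. c * indicator {a..b} x :: real)"
proof -
  have "integrable halfline (indicator {a..b} :: real \<Rightarrow> real)"
  proof (subst integrable_restrict_space)
    have "emeasure lborel ({0<..} \<inter> {a..b}) \<le> emeasure lborel {a..b}"
      by (intro emeasure_mono) auto
    also have "\<dots> < \<infinity>"
      by (simp add: emeasure_lborel_Icc_eq)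
    finally show "integrable lebesgue (\<lambda>x. indicator {0<..} x *\<^sub>R (indicator {a..b} x :: real))"
      by (auto simp: indicator_inter_arith[symmetric] emeasure_completion intro!: integrable_real_indicator)
  qed auto
  then show ?thesis by simp
qed

lemma AE_halfline_negligible:
  assumes "negligible N"
  shows "AE x in halfline. x \<notin> N"
proof -
  have "AE x in lebesgue. x \<notin> N"
    using assms by (intro AE_not_in) (simp add: negligible_iff_null_sets)
  then show ?thesis
    by (subst AE_restrict_space_iff) auto
qed

text \<open>Measurability yields continuous functions converging to \<open>g\<close> off a null set,
  but without control of size or support. Projecting their values to the disc of radius
  \<open>M\<close> and multiplying by a cut-off preserves continuity and the limit, and supplies a
  dominating function.\<close>

lemma continuous_approx_bounded:
  fixes g :: "real \<Rightarrow> complex"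
  assumes "0 < a" "a \<le> b" and g: "g \<in> borel_measurable halfline"
    and M: "\<And>x. cmod (g x) \<le> M" and g0: "\<And>x. x \<notin> {a..b} \<Longrightarrow> g x = 0" and "e > 0"
  obtains c where "continuous_on UNIV c" "\<And>x. x \<le> a / 2 \<or> x \<ge> b + 1 \<Longrightarrow> c x = 0"
    "c \<in> borel_measurable halfline" "\<And>x. cmod (c x) \<le> M * indicator {a / 2..b + 1} x" "L12_dist g c < e"
proof -
  have "g measurable_on {0<..}"
    using g by (subst measurable_on_iff_borel_measurable) auto
  then obtain N G where N: "negligible N" and G: "\<And>n. continuous_on UNIV (G n)"
    "\<And>x. x \<notin> N \<Longrightarrow> (\<lambda>n. G n x) \<longlonglongrightarrow> (if x \<in> {0<..} then g x else 0)"
    unfolding measurable_on_def by auto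
  have "M \<ge> 0" using M[of 0] norm_ge_zero order_trans by blast
  define P :: "complex \<Rightarrow> complex" where "P = closest_point (cball 0 M)"
  have P: "continuous_on UNIV P" "cmod (P z) \<le> M" "cmod z \<le> M \<Longrightarrow> P z = z" for z
    using closest_point_in_set[of "cball 0 M" z] \<open>M \<ge> 0\<close>
    by (auto simp: P_def closest_point_self intro!: continuous_on_closest_point)
  \<comment> \<open>Piecewise linear: 1 on [a, b] and 0 outside (a/2, b + 1). The left ramp ends at
    a/2, keeping the support away from 0.\<close>
  define cut where "cut x = max 0 (min 1 (min (2 * x / a - 1) (b + 1 - x)))" for x :: real
  have cut: "0 \<le> cut x" "cut x \<le> 1" for x by (auto simp: cut_def)
  have cut0: "cut x = 0" if "x \<le> a / 2 \<or> x \<ge> b + 1" for x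
  proof -
    have "2 * x / a - 1 \<le> 0 \<or> b + 1 - x \<le> 0"
      using that assms by (auto simp: field_simps)
    then show ?thesis by (auto simp: cut_def)
  qed
  have cut1: "cut x = 1" if "x \<in> {a..b}" for x
  proof -
    have "2 * x / a - 1 \<ge> 1" "b + 1 - x \<ge> 1"
      using that assms by (auto simp: field_simps)
    then show ?thesis by (simp add: cut_def)
  qed
  define c where "c n x = of_real (cut x) * P (G n x)" for n x
  have cont: "continuous_on UNIV (c n)" for n
  proof -
    have "continuous_on UNIV (\<lambda>x. P (G n x))"
      by (rule continuous_on_compose2[OF P(1) G(1)]) auto
    then show ?thesis
      unfolding c_def cut_def[abs_def] using assms(1) by (intro continuous_intros) auto
  qed
  have c0: "c n x = 0" if "x \<le> a / 2 \<or> x \<ge> b + 1" for n x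
    using cut0[OF that] by (simp add: c_def)
  have c_meas: "c n \<in> borel_measurable halfline" for n
    using cont by (intro measurable_restrict_space1 measurable_completion)
      (simp add: borel_measurable_continuous_onI)
  let ?i = "\<lambda>x. indicator {a / 2..b + 1} x :: real"
  have c_le: "cmod (c n x) \<le> M * ?i x" for n x
  proof (cases "x \<in> {a / 2..b + 1}")
    case True
    then show ?thesis
      using mult_mono[OF cut(2)[of x] P(2)[of "G n x"]] cut[of x] \<open>M \<ge> 0\<close>
      by (simp add: c_def norm_mult)
  next
    case False
    then show ?thesis using c0[of x n] by auto
  qed
  have g_le: "cmod (g x) \<le> M * ?i x" for x
    using M[of x] g0[of x] assms(1,2) \<open>M \<ge> 0\<close> by (cases "x \<in> {a..b}") (auto simp: indicator_def)
  have "(\<lambda>n. L12_dist g (c n)) \<longlonglongrightarrow> 0"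
  proof (rule L12_dist_dominated_convergence[OF g c_meas])
    show "cmod (g x - c n x) \<le> (2 * M) * ?i x" for x n
      using norm_triangle_ineq4[of "g x" "c n x"] g_le[of x] c_le[of n x] by simp
    show "integrable halfline (\<lambda>x. (2 * M) * ?i x)"
      by (rule integrable_halfline_interval)
    have "((2 * M) * ?i x)\<^sup>2 = (2 * M)\<^sup>2 * ?i x" for x
      by (simp add: indicator_def)
    then show "integrable halfline (\<lambda>x. ((2 * M) * ?i x)\<^sup>2)"
      using integrable_halfline_interval by simp
    have lim: "(\<lambda>n. c n x) \<longlonglongrightarrow> g x" if "x \<notin> N" "x > 0" for x
    proof -
      have "isCont P (g x)"
        using P(1) continuous_on_eq_continuous_at[of UNIV P] by simp
      moreover have "(\<lambda>n. G n x) \<longlonglongrightarrow> g x"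
        using G(2)[OF that(1)] that(2) by simp
      ultimately have "(\<lambda>n. P (G n x)) \<longlonglongrightarrow> P (g x)"
        by (rule isCont_tendsto_compose)
      then have "(\<lambda>n. c n x) \<longlonglongrightarrow> of_real (cut x) * g x"
        unfolding c_def using P(3)[OF M] by (auto intro!: tendsto_eq_intros)
      moreover have "of_real (cut x) * g x = g x"
        using cut1[of x] g0[of x] by (cases "x \<in> {a..b}") auto
      ultimately show ?thesis by simp
    qed
    show "AE x in halfline. (\<lambda>n. c n x) \<longlonglongrightarrow> g x"
      using AE_halfline_negligible[OF N] AE_space[of halfline] by eventually_elim (auto intro: lim)
  qed
  then have "eventually (\<lambda>n. L12_dist g (c n) < e) sequentially"
    using \<open>e > 0\<close> by (rule order_tendstoD)
  then obtain n where "L12_dist g (c n) < e"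
    by (auto simp: eventually_sequentially)
  then show thesis
    using that[of "c n"] cont c0 c_meas c_le by blast
qed

lemma bounded_support_L1_L2:
  fixes g :: "real \<Rightarrow> complex"
  assumes "g \<in> borel_measurable halfline" "\<And>x. cmod (g x) \<le> M * indicator {a..b} x"
  shows "integrable halfline g" "g \<in> L2_halfline"
proof -
  note [measurable] = assms(1)
  show "integrable halfline g"
    by (rule Bochner_Integration.integrable_bound[OF integrable_halfline_interval[of M a b] assms(1)])
       (use assms(2) in \<open>auto intro!: AE_I2 intro: order_trans[OF _ abs_ge_self]\<close>)
  have "(cmod (g x))\<^sup>2 \<le> M\<^sup>2 * indicator {a..b} x" for x
    using power_mono[OF assms(2)[of x], of 2] by (cases "x \<in> {a..b}") (auto simp: power_mult_distrib)
  then have "integrable halfline (\<lambda>x. (cmod (g x))\<^sup>2)"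
    by (intro Bochner_Integration.integrable_bound[OF integrable_halfline_interval[of "M\<^sup>2" a b]])
       (auto intro!: AE_I2)
  then show "g \<in> L2_halfline" by (simp add: L2_halfline_def)
qed

proposition hankel_nice_dense:
  assumes \<alpha>: "\<alpha> > - 1 / 2" and f: "integrable halfline f" "f \<in> L2_halfline" and "e > 0"
  obtains \<phi> where "hankel_nice \<alpha> \<phi>" "L12_dist f \<phi> < e"
proof -
  note [measurable] = L2_halflineD(1)[OF f(2)]
  \<comment> \<open>Truncation in the domain, away from 0 and infinity, and in the values. The bound
    on the values is needed for the continuous approximation.\<close>
  define s where "s n x = f x * indicator {1 / real (Suc n)..real (Suc n)} x *
      indicator {x. cmod (f x) \<le> real n} x" for n x
  have sm: "s n \<in> borel_measurable halfline" for n
    unfolding s_def[abs_def] by measurable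
  have "(\<lambda>n. L12_dist f (s n)) \<longlonglongrightarrow> 0"
  proof (rule L12_dist_dominated_convergence)
    show "f \<in> borel_measurable halfline" by measurable
    show "integrable halfline (\<lambda>x. cmod (f x))" using f(1) by simp
    show "integrable halfline (\<lambda>x. (cmod (f x))\<^sup>2)" using f(2) by (rule L2_halflineD)
    show "cmod (f x - s n x) \<le> cmod (f x)" for n x
      by (auto simp: s_def indicator_def)
    have "(\<lambda>n. s n x) \<longlonglongrightarrow> f x" if "x > 0" for x
    proof (rule tendsto_eventually)
      define m where "m = nat \<lceil>max (max x (1 / x)) (cmod (f x))\<rceil>"
      have "s n x = f x" if "n \<ge> m" for n
      proof -
        have "x \<le> real n" "1 / x \<le> real n" "cmod (f x) \<le> real n"
          using that unfolding m_def by linarith+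
        moreover have "1 / real (Suc n) \<le> x"
          using \<open>1 / x \<le> real n\<close> \<open>x > 0\<close> by (simp add: field_simps)
        ultimately show ?thesis by (simp add: s_def)
      qed
      then show "eventually (\<lambda>n. s n x = f x) sequentially"
        by (auto simp: eventually_sequentially)
    qed
    then show "AE x in halfline. (\<lambda>n. s n x) \<longlonglongrightarrow> f x"
      by (intro AE_I2) auto
  qed (rule sm)
  \<comment> \<open>Two uses of the triangle inequality with factor 2 give weights 2, 4 and 4 to the
    three errors, hence a total below 10 e/16.\<close>
  then have "eventually (\<lambda>n. L12_dist f (s n) < e / 16) sequentially"
    using \<open>e > 0\<close> by (intro order_tendstoD) auto
  then obtain n where n: "L12_dist f (s n) < e / 16"
    by (auto simp: eventually_sequentially)
  let ?a = "1 / real (Suc n)" and ?b = "real (Suc n)"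
  have sle: "cmod (s n x) \<le> real n * indicator {?a..?b} x" for x
    by (simp add: s_def indicator_def)
  then have s12: "integrable halfline (s n)" "s n \<in> L2_halfline"
    using bounded_support_L1_L2 sm by blast+
  have "cmod (s n x) \<le> real n" "x \<notin> {?a..?b} \<Longrightarrow> s n x = 0" for x
    by (auto simp: s_def indicator_def)
  then obtain c where c: "continuous_on UNIV c" "\<And>x. x \<le> ?a / 2 \<or> x \<ge> ?b + 1 \<Longrightarrow> c x = 0"
    "c \<in> borel_measurable halfline" "\<And>x. cmod (c x) \<le> real n * indicator {?a / 2..?b + 1} x"
    "L12_dist (s n) c < e / 16"
    using continuous_approx_bounded[of ?a ?b "s n" "real n" "e / 16", OF _ _ sm] \<open>e > 0\<close>
    by (auto simp: field_simps)
  have c12: "integrable halfline c" "c \<in> L2_halfline"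
    using bounded_support_L1_L2 c(3,4) by blast+
  have "?a \<le> 1" "1 \<le> ?b" by auto
  moreover have "A / 2 < B + 1" if "A \<le> 1" "1 \<le> B" for A B :: real
    using that by linarith
  ultimately have "?a / 2 < ?b + 1" by blast
  then obtain \<phi> where \<phi>: "hankel_nice \<alpha> \<phi>" "L12_dist c \<phi> < e / 16"
    using hankel_nice_approx_continuous[of \<alpha> "?a / 2" "?b + 1" c "e / 16"] \<alpha> c(1,2) \<open>e > 0\<close> by auto
  have \<phi>12: "integrable halfline \<phi>" "\<phi> \<in> L2_halfline"
    using \<phi>(1) by (auto simp: hankel_nice_def)
  have "L12_dist f \<phi> < e"
    using L12_dist_triangle[OF f s12 \<phi>12] L12_dist_triangle[OF s12 c12 \<phi>12] n c(5) \<phi>(2) \<open>e > 0\<close> by simp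
  then show thesis using \<phi>(1) that by blast
qed

subsection \<open>The \<open>L\<^sup>2\<close> bound and inversion\<close>

proposition hankel_integral_L2_bound:
  assumes \<alpha>: "\<alpha> > - 1 / 2" and f: "integrable halfline f" "f \<in> L2_halfline"
  shows "hankel_integral \<alpha> f \<in> L2_halfline" and "L2_sq (hankel_integral \<alpha> f) \<le> 2 * L2_sq f"
proof -
  let ?H = "hankel_integral \<alpha>"
  have [measurable]: "?H f \<in> borel_measurable halfline"
    using f(2) by (intro hankel_integral_measurable L2_halflineD)
  obtain M where M: "M > 0" "\<And>f x. integrable halfline f \<Longrightarrow> x > 0 \<Longrightarrow>
      cmod (?H f x) \<le> M * (LINT t|halfline. cmod (f t))"
    using hankel_integral_bounded[OF \<alpha>] by blast
  \<comment> \<open>A fixed slack e, with the n-th approximation within e/(n+1): the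
    \<open>L^2\<close> error is then at most e for every n, and the \<open>L^1\<close> error still
    tends to 0.\<close>
  have *: "(\<integral>\<^sup>+x. ennreal ((cmod (?H f x))\<^sup>2) \<partial>halfline) \<le> ennreal (2 * L2_sq f + 2 * e)" if "e > 0" for e
  proof -
    have "\<exists>\<phi>. hankel_nice \<alpha> \<phi> \<and> L12_dist f \<phi> < e * inverse (real (Suc n))" for n
      using hankel_nice_dense[OF \<alpha> f, of "e * inverse (real (Suc n))"] that by auto
    then obtain \<phi> where \<phi>: "\<And>n. hankel_nice \<alpha> (\<phi> n)"
      "\<And>n. L12_dist f (\<phi> n) < e * inverse (real (Suc n))"
      by metis
    have \<phi>12: "integrable halfline (\<phi> n)" "\<phi> n \<in> L2_halfline" for n
      using \<phi>(1)[of n] by (auto simp: hankel_nice_def)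
    have H\<phi>: "?H (\<phi> n) \<in> L2_halfline" for n
      using \<phi>(1)[of n] by (auto simp: hankel_nice_def)
    have [measurable]: "?H (\<phi> n) \<in> borel_measurable halfline" for n
      using H\<phi> by (rule L2_halflineD)
    have conv: "(\<lambda>n. ?H (\<phi> n) x) \<longlonglongrightarrow> ?H f x" if "x > 0" for x
    proof -
      have "cmod (?H (\<phi> n) x - ?H f x) \<le> M * (e * inverse (real (Suc n)))" for n
      proof -
        have "cmod (?H (\<phi> n) x - ?H f x) = cmod (?H (\<lambda>t. f t - \<phi> n t) x)"
          using hankel_integral_diff[OF \<alpha> f(1) \<phi>12(1) that] by (simp add: norm_minus_commute)
        also have "\<dots> \<le> M * (LINT t|halfline. cmod (f t - \<phi> n t))"
          using f(1) \<phi>12(1) that by (intro M) auto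
        also have "\<dots> \<le> M * (e * inverse (real (Suc n)))"
          using L12_dist_bounds(1)[of f "\<phi> n"] \<phi>(2)[of n] M(1) by (intro mult_left_mono) auto
        finally show ?thesis .
      qed
      moreover have "(\<lambda>n. M * (e * inverse (real (Suc n)))) \<longlonglongrightarrow> 0"
        using tendsto_mult[OF tendsto_const[of M] tendsto_mult[OF tendsto_const[of e] LIMSEQ_inverse_real_of_nat]]
        by simp
      ultimately have "(\<lambda>n. ?H (\<phi> n) x - ?H f x) \<longlonglongrightarrow> 0"
        by (rule Lim_null_comparison[OF always_eventually[OF allI]])
      then show ?thesis by (simp add: LIM_zero_iff)
    qed
    have le: "(\<integral>\<^sup>+x. ennreal ((cmod (?H (\<phi> n) x))\<^sup>2) \<partial>halfline) \<le> ennreal (2 * L2_sq f + 2 * e)" for n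
    proof -
      have "(\<integral>\<^sup>+x. ennreal ((cmod (?H (\<phi> n) x))\<^sup>2) \<partial>halfline) = ennreal (L2_sq (?H (\<phi> n)))"
        unfolding L2_sq_def using L2_halflineD(2)[OF H\<phi>] by (intro nn_integral_eq_integral) auto
      also have "L2_sq (?H (\<phi> n)) = L2_sq (\<phi> n)"
        by (rule hankel_nice_isometry[OF \<alpha> \<phi>(1)])
      also have "L2_sq (\<phi> n) \<le> 2 * L2_sq (\<lambda>x. \<phi> n x - f x) + 2 * L2_sq f"
        by (rule L2_sq_le_diff[OF \<phi>12(2) f(2)])
      also have "L2_sq (\<lambda>x. \<phi> n x - f x) \<le> e"
      proof -
        have "e * inverse (real (Suc n)) \<le> e * 1"
          using \<open>e > 0\<close> by (intro mult_left_mono) (auto simp: field_simps)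
        then show ?thesis
          using L12_dist_bounds(2)[of f "\<phi> n"] \<phi>(2)[of n] L2_sq_diff_commute[of "\<phi> n" f] by simp
      qed
      finally show ?thesis by (simp add: add.commute ennreal_leI)
    qed
    have "(\<integral>\<^sup>+x. ennreal ((cmod (?H f x))\<^sup>2) \<partial>halfline)
        = (\<integral>\<^sup>+x. liminf (\<lambda>n. ennreal ((cmod (?H (\<phi> n) x))\<^sup>2)) \<partial>halfline)"
    proof (rule nn_integral_cong)
      fix x assume "x \<in> space halfline"
      then have "(\<lambda>n. ennreal ((cmod (?H (\<phi> n) x))\<^sup>2)) \<longlonglongrightarrow> ennreal ((cmod (?H f x))\<^sup>2)"
        by (intro tendsto_ennrealI tendsto_power tendsto_norm conv) auto
      then show "ennreal ((cmod (?H f x))\<^sup>2) = liminf (\<lambda>n. ennreal ((cmod (?H (\<phi> n) x))\<^sup>2))"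
        by (intro lim_imp_Liminf[symmetric]) auto
    qed
    also have "\<dots> \<le> liminf (\<lambda>n. \<integral>\<^sup>+x. ennreal ((cmod (?H (\<phi> n) x))\<^sup>2) \<partial>halfline)"
      by (rule nn_integral_liminf) measurable
    also have "\<dots> \<le> limsup (\<lambda>n. \<integral>\<^sup>+x. ennreal ((cmod (?H (\<phi> n) x))\<^sup>2) \<partial>halfline)"
      by (rule Liminf_le_Limsup) simp
    also have "\<dots> \<le> ennreal (2 * L2_sq f + 2 * e)"
      using le by (intro Limsup_bounded always_eventually) auto
    finally show ?thesis .
  qed
  have int: "integrable halfline (\<lambda>x. (cmod (?H f x))\<^sup>2)"
    using *[of 1] by (intro integrableI_bounded) (auto simp: le_less_trans)
  then show "?H f \<in> L2_halfline" by (simp add: L2_halfline_def)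
  have "L2_sq (?H f) \<le> 2 * L2_sq f + e" if "e > 0" for e
  proof -
    have "ennreal (L2_sq (?H f)) \<le> ennreal (2 * L2_sq f + e)"
      using *[of "e / 2"] that int unfolding L2_sq_def[of "?H f"]
      by (simp add: nn_integral_eq_integral)
    then show ?thesis
      using that L2_sq_nonneg[of f] by (subst (asm) ennreal_le_iff) auto
  qed
  then show "L2_sq (?H f) \<le> 2 * L2_sq f"
    by (rule field_le_epsilon)
qed

text \<open>Three comparisons, h with H F_n, H F_n with F_n, and F_n with g, each cost a factor 2;
  the error terms vanish in the limit.\<close>

lemma has_hankel_transform_L2_bound:
  assumes \<alpha>: "\<alpha> > - 1 / 2" and gh: "has_hankel_transform \<alpha> g h"
  shows "L2_sq h \<le> 8 * L2_sq g"
proof -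
  obtain F where F: "\<And>n. integrable halfline (F n)" "\<And>n. F n \<in> L2_halfline"
      "\<And>n. hankel_integral \<alpha> (F n) \<in> L2_halfline"
    and lim: "(\<lambda>n. L2_norm (\<lambda>t. F n t - g t)) \<longlonglongrightarrow> 0"
      "(\<lambda>n. L2_norm (\<lambda>x. hankel_integral \<alpha> (F n) x - h x)) \<longlonglongrightarrow> 0"
    and L2: "g \<in> L2_halfline" "h \<in> L2_halfline"
    using gh unfolding has_hankel_transform_def by blast
  have lim2: "(\<lambda>n. L2_sq (\<lambda>t. F n t - g t)) \<longlonglongrightarrow> 0"
      "(\<lambda>n. L2_sq (\<lambda>x. hankel_integral \<alpha> (F n) x - h x)) \<longlonglongrightarrow> 0"
    using tendsto_power[OF lim(1), of 2] tendsto_power[OF lim(2), of 2]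
    by (simp_all add: L2_norm_power2)
  have "L2_sq h \<le> 2 * L2_sq (\<lambda>x. hankel_integral \<alpha> (F n) x - h x)
      + 2 * (2 * (2 * L2_sq (\<lambda>t. F n t - g t) + 2 * L2_sq g))" for n
    using L2_sq_le_diff[OF L2(2) F(3), of n] hankel_integral_L2_bound(2)[OF \<alpha> F(1,2), of n]
      L2_sq_le_diff[OF F(2) L2(1), of n] L2_sq_diff_commute[of h] by simp
  moreover have "(\<lambda>n. 2 * L2_sq (\<lambda>x. hankel_integral \<alpha> (F n) x - h x)
      + 2 * (2 * (2 * L2_sq (\<lambda>t. F n t - g t) + 2 * L2_sq g))) \<longlonglongrightarrow> 8 * L2_sq g"
    by (auto intro!: tendsto_eq_intros lim2)
  ultimately show ?thesis
    by (intro LIMSEQ_le_const) auto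
qed

text \<open>Nice functions \<open>\<phi>\<^sub>n\<close> close to the \<open>F\<^sub>n\<close> turn \<open>\<phi>\<^sub>n - H h\<close> into \<open>H (H \<phi>\<^sub>n - h)\<close>, which is small
  by the \<open>L\<^sup>2\<close> bound because \<open>h\<close> is integrable.\<close>

proposition hankel_inversion:
  assumes \<alpha>: "\<alpha> > - 1 / 2" and gh: "has_hankel_transform \<alpha> g h" and h: "integrable halfline h"
  shows "AE x in halfline. g x = hankel_integral \<alpha> h x"
proof -
  let ?H = "hankel_integral \<alpha>"
  obtain F where F: "\<And>n. integrable halfline (F n)" "\<And>n. F n \<in> L2_halfline"
      "\<And>n. ?H (F n) \<in> L2_halfline"
    and lim: "(\<lambda>n. L2_norm (\<lambda>t. F n t - g t)) \<longlonglongrightarrow> 0"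
      "(\<lambda>n. L2_norm (\<lambda>x. ?H (F n) x - h x)) \<longlonglongrightarrow> 0"
    and L2: "g \<in> L2_halfline" "h \<in> L2_halfline"
    using gh unfolding has_hankel_transform_def by blast
  have lim2: "(\<lambda>n. L2_sq (\<lambda>t. F n t - g t)) \<longlonglongrightarrow> 0"
      "(\<lambda>n. L2_sq (\<lambda>x. ?H (F n) x - h x)) \<longlonglongrightarrow> 0"
    using tendsto_power[OF lim(1), of 2] tendsto_power[OF lim(2), of 2]
    by (simp_all add: L2_norm_power2)
  have "\<exists>\<phi>. hankel_nice \<alpha> \<phi> \<and> L12_dist (F n) \<phi> < inverse (real (Suc n))" for n
    using hankel_nice_dense[OF \<alpha> F(1) F(2), of "inverse (real (Suc n))" n] by auto
  then obtain \<phi> where \<phi>: "\<And>n. hankel_nice \<alpha> (\<phi> n)" "\<And>n. L12_dist (F n) (\<phi> n) < inverse (real (Suc n))"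
    by metis
  have \<phi>12: "integrable halfline (\<phi> n)" "\<phi> n \<in> L2_halfline"
      "integrable halfline (?H (\<phi> n))" "?H (\<phi> n) \<in> L2_halfline" for n
    using \<phi>(1)[of n] by (auto simp: hankel_nice_def)
  have d1: "L2_sq (\<lambda>x. F n x - \<phi> n x) \<le> inverse (real (Suc n))" for n
    using L12_dist_bounds(2)[of "F n" "\<phi> n"] \<phi>(2)[of n] by simp
  have Hh: "?H h \<in> L2_halfline"
    by (rule hankel_integral_L2_bound[OF \<alpha> h L2(2)])
  have a: "L2_sq (\<lambda>x. \<phi> n x - ?H h x) \<le>
      8 * inverse (real (Suc n)) + 4 * L2_sq (\<lambda>x. ?H (F n) x - h x)" for n
  proof -
    have "L2_sq (\<lambda>x. \<phi> n x - ?H h x) = L2_sq (?H (\<lambda>x. ?H (\<phi> n) x - h x))"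
      using hankel_integral_diff[OF \<alpha> \<phi>12(3) h] \<phi>(1)[of n]
      by (intro L2_sq_cong) (simp add: hankel_nice_def)
    also have "\<dots> \<le> 2 * L2_sq (\<lambda>x. ?H (\<phi> n) x - h x)"
      using \<phi>12 h L2 by (intro hankel_integral_L2_bound[OF \<alpha>] L2_halfline_diff) auto
    also have "L2_sq (\<lambda>x. ?H (\<phi> n) x - h x) \<le>
        2 * L2_sq (\<lambda>x. ?H (\<phi> n) x - ?H (F n) x) + 2 * L2_sq (\<lambda>x. ?H (F n) x - h x)"
      by (rule L2_sq_triangle[OF \<phi>12(4) F(3) L2(2)])
    also have "L2_sq (\<lambda>x. ?H (\<phi> n) x - ?H (F n) x) = L2_sq (?H (\<lambda>x. \<phi> n x - F n x))"
      using hankel_integral_diff[OF \<alpha> \<phi>12(1) F(1)] by (intro L2_sq_cong) simp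
    also have "\<dots> \<le> 2 * L2_sq (\<lambda>x. \<phi> n x - F n x)"
      using \<phi>12 F by (intro hankel_integral_L2_bound[OF \<alpha>] L2_halfline_diff) auto
    also have "\<dots> \<le> 2 * inverse (real (Suc n))"
      using d1[of n] L2_sq_diff_commute[of "\<phi> n" "F n"] by simp
    finally show ?thesis by simp
  qed
  \<comment> \<open>The chain runs from g through F_n and \<phi>_n to H h; every link tends to 0, so
    the fixed left side is 0.\<close>
  have "L2_sq (\<lambda>x. g x - ?H h x) \<le> 2 * (2 * L2_sq (\<lambda>t. F n t - g t) + 2 * inverse (real (Suc n)))
      + 2 * (8 * inverse (real (Suc n)) + 4 * L2_sq (\<lambda>x. ?H (F n) x - h x))" for n
    using L2_sq_triangle[OF L2(1) \<phi>12(2) Hh, of n] L2_sq_triangle[OF L2(1) F(2) \<phi>12(2), of n n]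
      a[of n] d1[of n] L2_sq_diff_commute[of g "F n"] by simp
  moreover have "(\<lambda>n. 2 * (2 * L2_sq (\<lambda>t. F n t - g t) + 2 * inverse (real (Suc n)))
      + 2 * (8 * inverse (real (Suc n)) + 4 * L2_sq (\<lambda>x. ?H (F n) x - h x))) \<longlonglongrightarrow> 0"
    by (rule tendsto_eq_intros lim2 LIMSEQ_inverse_real_of_nat refl)+ simp
  ultimately have "L2_sq (\<lambda>x. g x - ?H h x) \<le> 0"
    by (intro LIMSEQ_le_const) auto
  then have "L2_sq (\<lambda>x. g x - ?H h x) = 0"
    using L2_sq_nonneg by (rule antisym)
  then have "AE x in halfline. (cmod (g x - ?H h x))\<^sup>2 = 0"
    unfolding L2_sq_def
    using integral_nonneg_eq_0_iff_AE[OF L2_halflineD(2)[OF L2_halfline_diff(1)[OF L2(1) Hh]]] by simp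
  then show ?thesis by simp
qed

lemma hankel_integral_continuous:
  assumes \<alpha>: "\<alpha> > - 1 / 2" and f: "integrable halfline f"
  shows "continuous_on {0<..} (hankel_integral \<alpha> f)"
proof (rule continuous_on_sequentiallyI)
  fix X :: "nat \<Rightarrow> real" and x assume X: "\<forall>n. X n \<in> {0<..}" "X \<longlonglongrightarrow> x" and x: "x \<in> {0<..}"
  obtain M where M: "M > 0" "\<And>y. y > 0 \<Longrightarrow> \<bar>hankel_kernel \<alpha> y\<bar> \<le> M"
    using hankel_kernel_bounded[OF \<alpha>] by blast
  note [measurable] = borel_measurable_integrable[OF f]
  show "(\<lambda>n. hankel_integral \<alpha> f (X n)) \<longlonglongrightarrow> hankel_integral \<alpha> f x"
    unfolding hankel_integral_kernel
  proof (rule integral_dominated_convergence)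
    show "integrable halfline (\<lambda>t. M * cmod (f t))" using f by simp
    have "(\<lambda>n. hankel_kernel \<alpha> (X n * t)) \<longlonglongrightarrow> hankel_kernel \<alpha> (x * t)" if "t > 0" for t
    proof (rule isCont_tendsto_compose[where g = "hankel_kernel \<alpha>"])
      show "isCont (hankel_kernel \<alpha>) (x * t)"
        using continuous_on_hankel_kernel[of \<alpha>] \<alpha> x that
        by (simp add: continuous_on_eq_continuous_at)
      show "(\<lambda>n. X n * t) \<longlonglongrightarrow> x * t" using X(2) by (intro tendsto_intros)
    qed
    then show "AE t in halfline. (\<lambda>n. f t * of_real (hankel_kernel \<alpha> (X n * t))) \<longlonglongrightarrow>
        f t * of_real (hankel_kernel \<alpha> (x * t))"
      by (intro AE_I2 tendsto_intros) auto
    show "AE t in halfline. norm (f t * of_real (hankel_kernel \<alpha> (X n * t))) \<le> M * cmod (f t)" for n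
      using M(2) X(1) by (intro AE_I2) (simp add: norm_mult mult_left_mono mult.commute[of M "norm _"])
  qed measurable
qed

text \<open>The set of disagreement is open, and a nonempty open set is not negligible. This turns
  almost everywhere inversion into a statement about point values.\<close>

lemma continuous_AE_eq:
  fixes f g :: "real \<Rightarrow> complex"
  assumes "continuous_on {0<..} f" "continuous_on {0<..} g" "AE x in halfline. f x = g x" "x > 0"
  shows "f x = g x"
proof (rule ccontr)
  assume "f x \<noteq> g x"
  define U where "U = (\<lambda>x. f x - g x) -` (- {0}) \<inter> {0<..}"
  have "open U"
    unfolding U_def using assms(1,2)
    by (intro continuous_on_open_vimage[THEN iffD1, rule_format] continuous_intros) auto
  moreover have "x \<in> U" using \<open>f x \<noteq> g x\<close> \<open>x > 0\<close> by (simp add: U_def)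
  moreover have "negligible U"
  proof -
    have "AE x in lebesgue. x \<in> {0<..} \<longrightarrow> f x = g x"
      using assms(3) by (subst (asm) AE_restrict_space_iff) auto
    then have "AE x in lebesgue. x \<notin> U"
      by eventually_elim (auto simp: U_def)
    moreover have "U \<in> sets lebesgue" using \<open>open U\<close> by auto
    ultimately show ?thesis
      by (simp add: negligible_iff_null_sets AE_iff_null_sets)
  qed
  ultimately show False
    using open_not_negligible by blast
qed

subsection \<open>The sampling estimate\<close>

lemma has_bochner_integral_halfline_lborel:
  fixes f :: "real \<Rightarrow> real"
  assumes "has_bochner_integral lborel f v" "\<And>x. x \<le> 0 \<Longrightarrow> f x = 0"
  shows "has_bochner_integral halfline f v"
proof -
  have [measurable]: "f \<in> borel_measurable lborel"
    using assms(1) by auto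
  have "integrable lebesgue f" "integral\<^sup>L lebesgue f = v"
    using assms(1) by (auto simp: has_bochner_integral_iff integrable_completion integral_completion)
  moreover have "(\<lambda>x. indicator {0<..} x *\<^sub>R f x) = f"
  proof
    show "indicator {0<..} x *\<^sub>R f x = f x" for x
      using assms(2)[of x] by (cases "x > 0") auto
  qed
  ultimately show ?thesis
    by (simp add: has_bochner_integral_iff integrable_restrict_space integral_restrict_space)
qed

lemma has_bochner_integral_halfline_interval:
  assumes "0 < a" "a \<le> b"
  shows "has_bochner_integral halfline (indicator {a..<b} :: real \<Rightarrow> real) (b - a)"
  using assms
  by (intro has_bochner_integral_halfline_lborel)
     (auto simp: has_bochner_integral_iff intro!: integrable_real_indicator)

lemma has_bochner_integral_halfline_initial:
  assumes "0 < R"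
  shows "has_bochner_integral halfline (indicator {0<..R} :: real \<Rightarrow> real) R"
  using assms
  by (intro has_bochner_integral_halfline_lborel)
     (auto simp: has_bochner_integral_iff intro!: integrable_real_indicator)

text \<open>Expanding the nonnegative integral of (|f| - l)^2 over \<open>A\<close>, with l the mean
  of |f| on \<open>A\<close>, gives the inequality. Integrability comes from r <= 1 + r^2 and the
  finite measure of \<open>A\<close>.\<close>

lemma Cauchy_Schwarz_halfline_indicator:
  fixes f :: "real \<Rightarrow> complex"
  assumes A: "has_bochner_integral halfline (indicator A :: real \<Rightarrow> real) m" and "m > 0"
    and f: "f \<in> borel_measurable halfline" "integrable halfline (\<lambda>x. indicator A x * (cmod (f x))\<^sup>2)"
  shows "integrable halfline (\<lambda>x. indicator A x * cmod (f x))"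
    and "(LINT x|halfline. indicator A x * cmod (f x))\<^sup>2 \<le>
      m * (LINT x|halfline. indicator A x * (cmod (f x))\<^sup>2)"
proof -
  note [measurable] = f(1)
  have iA: "integrable halfline (indicator A :: real \<Rightarrow> real)" and mA: "integral\<^sup>L halfline (indicator A) = m"
    using A by (auto simp: has_bochner_integral_iff)
  note [measurable] = borel_measurable_integrable[OF iA]
  have le: "r \<le> 1 + r\<^sup>2" if "r \<ge> 0" for r :: real
    using sum_squares_bound[of r 1] zero_le_power2[of r] that by simp
  show i: "integrable halfline (\<lambda>x. indicator A x * cmod (f x))"
  proof (rule Bochner_Integration.integrable_bound)
    show "integrable halfline (\<lambda>x. indicator A x + indicator A x * (cmod (f x))\<^sup>2)"
      using iA f(2) by simp
    show "AE x in halfline. norm (indicator A x * cmod (f x)) \<le> norm (indicator A x + indicator A x * (cmod (f x))\<^sup>2)"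
      using le by (intro AE_I2) (auto simp: indicator_def)
  qed measurable
  define I where "I = (LINT x|halfline. indicator A x * cmod (f x))"
  define l where "l = I / m"
  have "0 \<le> (LINT x|halfline. indicator A x * (cmod (f x) - l)\<^sup>2)"
    by simp
  also have "\<dots> = (LINT x|halfline. indicator A x * (cmod (f x))\<^sup>2 - (2 * l) * (indicator A x * cmod (f x))
      + l\<^sup>2 * indicator A x)"
    by (simp add: power2_diff algebra_simps)
  also have "\<dots> = (LINT x|halfline. indicator A x * (cmod (f x))\<^sup>2) - (2 * l) * I + l\<^sup>2 * m"
    using i f(2) iA unfolding I_def mA[symmetric] by simp
  also have "\<dots> = (LINT x|halfline. indicator A x * (cmod (f x))\<^sup>2) - I\<^sup>2 / m"
    using \<open>m > 0\<close> by (simp add: l_def power2_eq_square field_simps)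
  finally show "I\<^sup>2 \<le> m * (LINT x|halfline. indicator A x * (cmod (f x))\<^sup>2)"
    using \<open>m > 0\<close> by (simp add: field_simps)
qed

lemma L2_halfline_integrable_indicator:
  fixes f :: "real \<Rightarrow> complex"
  assumes "f \<in> L2_halfline" "A \<in> sets lborel"
  shows "integrable halfline (\<lambda>x. indicator A x * (cmod (f x))\<^sup>2)"
proof -
  note [measurable] = L2_halflineD(1)[OF assms(1)]
  have [measurable]: "indicator A \<in> borel_measurable halfline"
    using assms(2) by (intro measurable_restrict_space1 measurable_completion) auto
  show ?thesis
  proof (rule Bochner_Integration.integrable_bound[OF L2_halflineD(2)[OF assms(1)]])
    show "(\<lambda>x. indicator A x * (cmod (f x))\<^sup>2) \<in> borel_measurable halfline"
      by measurable
  qed (auto simp: indicator_def)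
qed

lemma compact_support_L2:
  assumes "h \<in> L2_halfline" "R > 0" "\<And>x. x > R \<Longrightarrow> h x = 0"
  shows "integrable halfline h" "(LINT x|halfline. cmod (h x))\<^sup>2 \<le> R * L2_sq h"
    "(\<lambda>x. of_real x * h x) \<in> L2_halfline" "integrable halfline (\<lambda>x. of_real x * h x)"
    "L2_sq (\<lambda>x. of_real x * h x) \<le> R\<^sup>2 * L2_sq h"
proof -
  \<comment> \<open>Stated for a fresh \<open>h\<close> because it is applied to x h(x) as
    well.\<close>
  have *: "integrable halfline h \<and> (LINT x|halfline. cmod (h x))\<^sup>2 \<le> R * L2_sq h"
    if h: "h \<in> L2_halfline" "\<And>x. x > R \<Longrightarrow> h x = 0" for h
  proof -
    let ?A = "{0<..R}"
    have cs: "integrable halfline (\<lambda>x. indicator ?A x * cmod (h x))"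
      "(LINT x|halfline. indicator ?A x * cmod (h x))\<^sup>2 \<le> R * (LINT x|halfline. indicator ?A x * (cmod (h x))\<^sup>2)"
      using Cauchy_Schwarz_halfline_indicator[OF has_bochner_integral_halfline_initial[OF assms(2)] assms(2)
          L2_halflineD(1)[OF h(1)] L2_halfline_integrable_indicator[OF h(1)]] by auto
    have 1: "indicator ?A x * cmod (h x) = cmod (h x)" if "x > 0" for x
      using h(2)[of x] that by (auto simp: indicator_def)
    have 2: "indicator ?A x * (cmod (h x))\<^sup>2 = (cmod (h x))\<^sup>2" if "x > 0" for x
      using h(2)[of x] that by (auto simp: indicator_def)
    have "integrable halfline (\<lambda>x. cmod (h x))"
      using cs(1) by (subst (asm) integrable_halfline_cong[OF 1])
    then have "integrable halfline h"
      using L2_halflineD(1)[OF h(1)] integrable_norm_iff by blast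
    moreover have "(LINT x|halfline. indicator ?A x * cmod (h x)) = (LINT x|halfline. cmod (h x))"
      using 1 by (intro Bochner_Integration.integral_cong) auto
    moreover have "(LINT x|halfline. indicator ?A x * (cmod (h x))\<^sup>2) = L2_sq h"
      unfolding L2_sq_def using 2 by (intro Bochner_Integration.integral_cong) auto
    ultimately show ?thesis using cs(2) by simp
  qed
  show "integrable halfline h" "(LINT x|halfline. cmod (h x))\<^sup>2 \<le> R * L2_sq h"
    using *[OF assms(1,3)] by auto
  note [measurable] = L2_halflineD(1)[OF assms(1)]
  have i: "integrable halfline (\<lambda>x. R\<^sup>2 * (cmod (h x))\<^sup>2)"
    using L2_halflineD(2)[OF assms(1)] by simp
  have le: "(cmod (of_real x * h x))\<^sup>2 \<le> R\<^sup>2 * (cmod (h x))\<^sup>2" if "x > 0" for x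
  proof (cases "x > R")
    case False
    then show ?thesis
      using that by (simp add: norm_mult power_mult_distrib mult_right_mono power_mono)
  qed (simp add: assms(3))
  have j: "integrable halfline (\<lambda>x. (cmod (of_real x * h x))\<^sup>2)"
    by (rule Bochner_Integration.integrable_bound[OF i])
       (use le in \<open>auto intro!: AE_I2\<close>)
  then show xh: "(\<lambda>x. of_real x * h x) \<in> L2_halfline"
    by (simp add: L2_halfline_def)
  show "integrable halfline (\<lambda>x. of_real x * h x)"
    using *[OF xh] assms(3) by auto
  have "L2_sq (\<lambda>x. of_real x * h x) \<le> (LINT x|halfline. R\<^sup>2 * (cmod (h x))\<^sup>2)"
    unfolding L2_sq_def using le by (intro integral_mono i j) auto
  then show "L2_sq (\<lambda>x. of_real x * h x) \<le> R\<^sup>2 * L2_sq h"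
    by (simp add: L2_sq_def)
qed

text \<open>The fundamental theorem of calculus for u with x fixed. The inner derivative x cancels
  against 1/(u x) in the first term but survives in the second, which is the origin of x
  h(x).\<close>

lemma hankel_kernel_increment:
  assumes "\<alpha> > - 1" "0 < s" "s \<le> t" "x > 0"
  shows "has_bochner_integral halfline (\<lambda>u. ((\<alpha> + 1 / 2) / u * hankel_kernel \<alpha> (u * x)
      - x * hankel_kernel (\<alpha> + 1) (u * x)) * indicator {s..t} u)
    (hankel_kernel \<alpha> (t * x) - hankel_kernel \<alpha> (s * x))"
proof (rule has_bochner_integral_halfline_lborel)
  let ?D = "\<lambda>u. (\<alpha> + 1 / 2) / u * hankel_kernel \<alpha> (u * x) - x * hankel_kernel (\<alpha> + 1) (u * x)"
  have "((\<lambda>u. hankel_kernel \<alpha> (u * x)) has_real_derivative ?D u) (at u)" if "u > 0" for u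
  proof -
    have "((\<lambda>u. hankel_kernel \<alpha> (u * x)) has_real_derivative
        ((\<alpha> + 1 / 2) / (u * x) * hankel_kernel \<alpha> (u * x) - hankel_kernel (\<alpha> + 1) (u * x)) * x) (at u)"
      using that assms
      by (intro DERIV_chain2[of "hankel_kernel \<alpha>"] hankel_kernel_deriv) (auto intro!: derivative_eq_intros)
    also have "((\<alpha> + 1 / 2) / (u * x) * hankel_kernel \<alpha> (u * x) - hankel_kernel (\<alpha> + 1) (u * x)) * x = ?D u"
      using assms that by (simp add: left_diff_distrib)
    finally show ?thesis .
  qed
  moreover have "isCont ?D u" if "u > 0" for u
  proof -
    have k: "isCont (\<lambda>u. hankel_kernel \<beta> (u * x)) u" if "\<beta> > -1" for \<beta>
    proof (rule isCont_o2[where g = "hankel_kernel \<beta>"])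
      show "isCont (hankel_kernel \<beta>) (u * x)"
        using hankel_kernel_deriv[of "u * x" \<beta>] that \<open>u > 0\<close> assms(4) by (auto intro: DERIV_isCont)
    qed (intro continuous_intros)
    show ?thesis
      using k[of \<alpha>] k[of "\<alpha> + 1"] that assms(1) by (intro continuous_intros) auto
  qed
  ultimately show "has_bochner_integral lborel (\<lambda>u. ?D u * indicator {s..t} u)
      (hankel_kernel \<alpha> (t * x) - hankel_kernel \<alpha> (s * x))"
    using assms by (intro has_bochner_integral_FTC_Icc_real) auto
qed (use assms in auto)

text \<open>Integrated form of \<open>(H\<^sub>\<alpha> h)'(u) = (\<alpha> + 1/2)/u H\<^sub>\<alpha> h(u) - H\<^bsub>\<alpha>+1\<^esub>(x h)(u)\<close>.\<close>

lemma hankel_integral_increment: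
  assumes \<alpha>: "\<alpha> > - 1 / 2" and st: "0 < s" "s \<le> t"
    and h: "integrable halfline h" "integrable halfline (\<lambda>x. of_real x * h x)"
  defines "D \<equiv> \<lambda>u. of_real ((\<alpha> + 1 / 2) / u) * hankel_integral \<alpha> h u
      - hankel_integral (\<alpha> + 1) (\<lambda>x. of_real x * h x) u"
  shows "hankel_integral \<alpha> h t - hankel_integral \<alpha> h s = (LINT u|halfline. indicator {s..t} u * D u)"
proof -
  define p where "p = \<alpha> + 1 / 2"
  \<comment> \<open>Integrating over \<open>u\<close> first gives the increment of the kernel,
    integrating over \<open>x\<close> first gives the integrand \<open>D\<close>; Fubini equates the
    two.\<close>
  define K where "K u x = indicator {s..t} u * (of_real (p / u) * (h x * of_real (hankel_kernel \<alpha> (u * x)))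
      - of_real x * h x * of_real (hankel_kernel (\<alpha> + 1) (u * x)))" for u x
  obtain M where M: "M > 0" "\<And>y. y > 0 \<Longrightarrow> \<bar>hankel_kernel \<alpha> y\<bar> \<le> M"
    using hankel_kernel_bounded[OF \<alpha>] by blast
  obtain M' where M': "M' > 0" "\<And>y. y > 0 \<Longrightarrow> \<bar>hankel_kernel (\<alpha> + 1) y\<bar> \<le> M'"
    using hankel_kernel_bounded[of "\<alpha> + 1"] \<alpha> by auto
  have p: "p > 0" using \<alpha> by (simp add: p_def)
  note [measurable] = borel_measurable_integrable[OF h(1)]
  have i: "integrable halfline (indicator {s..t} :: real \<Rightarrow> real)"
    using integrable_halfline_interval[of 1 s t] by simp
  \<comment> \<open>On [s, t] the coefficient p/u is at most p/s, so this bound times the indicator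
    of a bounded interval is integrable on the product.\<close>
  let ?w = "\<lambda>x. p / s * M * norm (h x) + M' * norm (of_real x * h x)"
  have w: "integrable halfline ?w" using h by simp
  have K_le: "norm (K u x) \<le> indicator {s..t} u * ?w x" if "u > 0" "x > 0" for u x
  proof (cases "u \<in> {s..t}")
    case True
    have "norm (K u x) \<le> norm (of_real (p / u) * (h x * of_real (hankel_kernel \<alpha> (u * x))))
        + norm (of_real x * h x * of_real (hankel_kernel (\<alpha> + 1) (u * x)))"
      using True by (simp add: K_def norm_triangle_ineq4)
    also have "norm (of_real (p / u) * (h x * of_real (hankel_kernel \<alpha> (u * x))))
        = p / u * \<bar>hankel_kernel \<alpha> (u * x)\<bar> * norm (h x)"
      using p that by (simp add: norm_mult norm_divide)
    also have "\<dots> \<le> p / s * M * norm (h x)"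
      using p True st M that by (intro mult_right_mono mult_mono divide_left_mono) auto
    also have "norm (of_real x * h x * of_real (hankel_kernel (\<alpha> + 1) (u * x)))
        = \<bar>hankel_kernel (\<alpha> + 1) (u * x)\<bar> * norm (of_real x * h x)"
      by (simp add: norm_mult)
    also have "\<dots> \<le> M' * norm (of_real x * h x)"
      using M' that by (intro mult_right_mono) auto
    finally show ?thesis using True by simp
  qed (simp add: K_def)
  have "integrable (halfline \<Otimes>\<^sub>M halfline) (\<lambda>(u, x). indicator {s..t} u * ?w x)"
    using w i by (intro halfline_pair.Fubini_integrable) (auto simp: abs_mult)
  then have "integrable (halfline \<Otimes>\<^sub>M halfline) (\<lambda>(u, x). K u x)"
  proof (rule Bochner_Integration.integrable_bound)
    show "AE q in halfline \<Otimes>\<^sub>M halfline. norm (case q of (u, x) \<Rightarrow> K u x)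
        \<le> norm (case q of (u, x) \<Rightarrow> indicator {s..t} u * ?w x)"
      using K_le by (intro AE_I2) (force simp: space_pair_measure intro: order_trans[OF _ abs_ge_self])
  qed (simp add: K_def)
  then have "(LINT x|halfline. LINT u|halfline. K u x) = (LINT u|halfline. LINT x|halfline. K u x)"
    by (rule halfline_pair.Fubini_integral)
  also have "\<dots> = (LINT u|halfline. indicator {s..t} u * D u)"
  proof (intro Bochner_Integration.integral_cong refl)
    fix u assume "u \<in> space halfline"
    then have u: "u > 0" by simp
    have "integrable halfline (\<lambda>x. h x * of_real (hankel_kernel \<alpha> (u * x)))"
      "integrable halfline (\<lambda>x. of_real x * h x * of_real (hankel_kernel (\<alpha> + 1) (u * x)))"
      using hankel_integral_integrable[OF \<alpha> h(1) u] hankel_integral_integrable[OF _ h(2) u, of "\<alpha> + 1"] \<alpha>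
      by auto
    then show "(LINT x|halfline. K u x) = indicator {s..t} u * D u"
      unfolding K_def D_def hankel_integral_kernel p_def by simp
  qed
  also have "(LINT x|halfline. LINT u|halfline. K u x) =
      (LINT x|halfline. h x * of_real (hankel_kernel \<alpha> (t * x)) - h x * of_real (hankel_kernel \<alpha> (s * x)))"
  proof (intro Bochner_Integration.integral_cong refl)
    fix x assume "x \<in> space halfline"
    then have x: "x > 0" by simp
    let ?d = "\<lambda>u. (p / u * hankel_kernel \<alpha> (u * x) - x * hankel_kernel (\<alpha> + 1) (u * x)) * indicator {s..t} u"
    have "(LINT u|halfline. K u x) = (LINT u|halfline. h x * of_real (?d u))"
      by (intro Bochner_Integration.integral_cong refl) (simp add: K_def algebra_simps indicator_def)
    also have "\<dots> = h x * of_real (LINT u|halfline. ?d u)"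
      by (simp only: integral_mult_right_zero integral_complex_of_real)
    also have "(LINT u|halfline. ?d u) = hankel_kernel \<alpha> (t * x) - hankel_kernel \<alpha> (s * x)"
      using hankel_kernel_increment[of \<alpha> s t x] \<alpha> st x by (simp add: has_bochner_integral_iff p_def)
    finally show "(LINT u|halfline. K u x) =
        h x * of_real (hankel_kernel \<alpha> (t * x)) - h x * of_real (hankel_kernel \<alpha> (s * x))"
      by (simp add: right_diff_distrib)
  qed
  also have "\<dots> = hankel_integral \<alpha> h t - hankel_integral \<alpha> h s"
    unfolding hankel_integral_kernel
    using hankel_integral_integrable[OF \<alpha> h(1)] st
    by (intro Bochner_Integration.integral_diff) auto
  finally show ?thesis .
qed

text \<open>A one-dimensional Sobolev estimate: |G(t)|^2 is compared with |G(s)|^2 plus d times the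
  integral of |D|^2, where D is the derivative of G, and then averaged over s in [t, t + d). Here
  \<open>G'\<close> is only the part of that derivative of order
  \<open>\<alpha> + 1\<close>.\<close>

lemma hankel_integral_point_bound:
  assumes \<alpha>: "\<alpha> > - 1 / 2" and d: "d > 0" "t \<ge> d"
    and h: "integrable halfline h" "h \<in> L2_halfline"
      "integrable halfline (\<lambda>x. of_real x * h x)" "(\<lambda>x. of_real x * h x) \<in> L2_halfline"
  defines "G \<equiv> hankel_integral \<alpha> h" and "G' \<equiv> hankel_integral (\<alpha> + 1) (\<lambda>x. of_real x * h x)"
    and "p \<equiv> \<alpha> + 1 / 2"
  shows "d * (cmod (G t))\<^sup>2 \<le> (LINT u|halfline. indicator {t..<t + d} u *
      ((2 + 4 * p\<^sup>2) * (cmod (G u))\<^sup>2 + 4 * d\<^sup>2 * (cmod (G' u))\<^sup>2))"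
proof -
  let ?A = "{t..<t + d}"
  define D where "D u = of_real (p / u) * G u - G' u" for u
  have G: "G \<in> L2_halfline" and G': "G' \<in> L2_halfline"
    unfolding G_def G'_def using \<alpha> h by (auto intro: hankel_integral_L2_bound)
  note [measurable] = L2_halflineD(1)[OF G] L2_halflineD(1)[OF G']
  have Dm[measurable]: "D \<in> borel_measurable halfline"
    unfolding D_def[abs_def] by measurable
  have t: "t > 0" using d by simp
  have A: "has_bochner_integral halfline (indicator ?A :: real \<Rightarrow> real) d"
    using has_bochner_integral_halfline_interval[of t "t + d"] t d by simp
  have iG: "integrable halfline (\<lambda>u. indicator ?A u * (cmod (G u))\<^sup>2)"
    and iG': "integrable halfline (\<lambda>u. indicator ?A u * (cmod (G' u))\<^sup>2)"
    using L2_halfline_integrable_indicator[OF G] L2_halfline_integrable_indicator[OF G'] by auto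
  have D_le: "indicator ?A u * (cmod (D u))\<^sup>2 \<le>
      2 * (p / d)\<^sup>2 * (indicator ?A u * (cmod (G u))\<^sup>2) + 2 * (indicator ?A u * (cmod (G' u))\<^sup>2)" for u
  proof (cases "u \<in> ?A")
    case True
    have "(cmod (D u))\<^sup>2 \<le> 2 * (cmod (of_real (p / u) * G u))\<^sup>2 + 2 * (cmod (G' u))\<^sup>2"
      using cmod_add_power2_le[of "of_real (p / u) * G u" "- G' u"] by (simp add: D_def)
    also have "(cmod (of_real (p / u) * G u))\<^sup>2 = (p / u)\<^sup>2 * (cmod (G u))\<^sup>2"
      by (simp add: norm_mult norm_divide power_mult_distrib power_divide)
    \<comment> \<open>Uses u >= t >= d, so it is available only for sampling points away from
      0.\<close>
    also have "(p / u)\<^sup>2 \<le> (p / d)\<^sup>2"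
      using True d \<alpha> unfolding p_def by (intro power_mono divide_left_mono) auto
    finally show ?thesis using True by (simp add: mult_right_mono)
  qed simp
  have iD: "integrable halfline (\<lambda>u. indicator ?A u * (cmod (D u))\<^sup>2)"
  proof (rule Bochner_Integration.integrable_bound)
    show "integrable halfline (\<lambda>u. 2 * (p / d)\<^sup>2 * (indicator ?A u * (cmod (G u))\<^sup>2) +
        2 * (indicator ?A u * (cmod (G' u))\<^sup>2))"
      using iG iG' by (intro Bochner_Integration.integrable_add integrable_mult_right)
    show "AE u in halfline. norm (indicator ?A u * (cmod (D u))\<^sup>2) \<le>
      norm (2 * (p / d)\<^sup>2 * (indicator ?A u * (cmod (G u))\<^sup>2) + 2 * (indicator ?A u * (cmod (G' u))\<^sup>2))"
      using D_le by (intro AE_I2) (force intro: order_trans[OF _ abs_ge_self])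
    show "(\<lambda>u. indicator ?A u * (cmod (D u))\<^sup>2) \<in> borel_measurable halfline"
      by measurable
  qed
  define Q where "Q = (LINT u|halfline. indicator ?A u * (cmod (D u))\<^sup>2)"
  have cs: "integrable halfline (\<lambda>u. indicator ?A u * cmod (D u))"
      "(LINT u|halfline. indicator ?A u * cmod (D u))\<^sup>2 \<le> d * Q"
    using Cauchy_Schwarz_halfline_indicator[OF A d(1) Dm iD] by (auto simp: Q_def)
  have incr: "(cmod (G t))\<^sup>2 \<le> 2 * (cmod (G s))\<^sup>2 + 2 * (d * Q)" if "s \<in> ?A" for s
  proof -
    have "G s - G t = (LINT u|halfline. indicator {t..s} u * D u)"
      unfolding G_def G'_def D_def p_def
      using that t \<alpha> h by (intro hankel_integral_increment) auto
    then have "cmod (G t - G s) = cmod (LINT u|halfline. indicator {t..s} u * D u)"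
      by (metis norm_minus_commute)
    also have "\<dots> \<le> (LINT u|halfline. cmod (indicator {t..s} u * D u))"
      by (rule integral_norm_bound)
    also have "\<dots> \<le> (LINT u|halfline. indicator ?A u * cmod (D u))"
    proof (rule integral_mono')
      show "cmod (indicator {t..s} u * D u) \<le> indicator ?A u * cmod (D u)" for u
        using that by (auto simp: indicator_def)
    qed (use cs(1) in auto)
    finally have "(cmod (G t - G s))\<^sup>2 \<le> (LINT u|halfline. indicator ?A u * cmod (D u))\<^sup>2"
      by (intro power_mono) auto
    also note cs(2)
    finally show ?thesis
      using cmod_add_power2_le[of "G s" "G t - G s"] by simp
  qed
  have "d * (cmod (G t))\<^sup>2 = (LINT s|halfline. indicator ?A s * (cmod (G t))\<^sup>2)"
    using A by (simp add: has_bochner_integral_iff)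
  also have "\<dots> \<le> (LINT s|halfline. 2 * (indicator ?A s * (cmod (G s))\<^sup>2) + indicator ?A s * (2 * (d * Q)))"
  proof (rule integral_mono)
    show "indicator ?A s * (cmod (G t))\<^sup>2 \<le> 2 * (indicator ?A s * (cmod (G s))\<^sup>2) + indicator ?A s * (2 * (d * Q))" for s
      using incr[of s] by (cases "s \<in> ?A") auto
  qed (use A iG in \<open>auto simp: has_bochner_integral_iff\<close>)
  also have "\<dots> = 2 * (LINT s|halfline. indicator ?A s * (cmod (G s))\<^sup>2) + 2 * d\<^sup>2 * Q"
    using A iG by (simp add: has_bochner_integral_iff power2_eq_square)
  also have "Q \<le> (LINT u|halfline. 2 * (p / d)\<^sup>2 * (indicator ?A u * (cmod (G u))\<^sup>2) +
      2 * (indicator ?A u * (cmod (G' u))\<^sup>2))"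
    unfolding Q_def using iD iG iG' D_le by (intro integral_mono) auto
  also have "\<dots> = 2 * (p / d)\<^sup>2 * (LINT u|halfline. indicator ?A u * (cmod (G u))\<^sup>2) +
      2 * (LINT u|halfline. indicator ?A u * (cmod (G' u))\<^sup>2)"
    using iG iG' by (subst Bochner_Integration.integral_add) (auto simp del: times_divide_eq_left)
  \<comment> \<open>One factor d stems from Cauchy-Schwarz and one from the length of the averaging
    interval; together they cancel the square in (p/d)^2.\<close>
  also have "2 * (LINT s|halfline. indicator ?A s * (cmod (G s))\<^sup>2) + 2 * d\<^sup>2 *
      (2 * (p / d)\<^sup>2 * (LINT u|halfline. indicator ?A u * (cmod (G u))\<^sup>2) +
       2 * (LINT u|halfline. indicator ?A u * (cmod (G' u))\<^sup>2))
    = (2 + 4 * p\<^sup>2) * (LINT u|halfline. indicator ?A u * (cmod (G u))\<^sup>2) +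
      4 * d\<^sup>2 * (LINT u|halfline. indicator ?A u * (cmod (G' u))\<^sup>2)"
    using d(1) by (simp add: power_divide field_simps)
  also have "\<dots> = (LINT u|halfline. (2 + 4 * p\<^sup>2) * (indicator ?A u * (cmod (G u))\<^sup>2) +
      4 * d\<^sup>2 * (indicator ?A u * (cmod (G' u))\<^sup>2))"
    using iG iG' by (subst Bochner_Integration.integral_add) auto
  also have "\<dots> = (LINT u|halfline. indicator ?A u *
      ((2 + 4 * p\<^sup>2) * (cmod (G u))\<^sup>2 + 4 * d\<^sup>2 * (cmod (G' u))\<^sup>2))"
    by (simp add: algebra_simps)
  finally show ?thesis
    using d by (simp add: mult_left_mono)
qed

text \<open>The intervals are disjoint, half-open ones even when two points are exactly d apart, so
  their indicators sum to at most 1.\<close>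

lemma sum_disjoint_interval_integrals_le:
  fixes \<phi> :: "real \<Rightarrow> real"
  assumes "finite F" "integrable halfline \<phi>" "\<And>u. \<phi> u \<ge> 0"
    and sep: "\<And>s t. s \<in> F \<Longrightarrow> t \<in> F \<Longrightarrow> s \<noteq> t \<Longrightarrow> \<bar>s - t\<bar> \<ge> d"
  shows "(\<Sum>t\<in>F. LINT u|halfline. indicator {t..<t + d} u * \<phi> u) \<le> integral\<^sup>L halfline \<phi>"
proof -
  note [measurable] = borel_measurable_integrable[OF assms(2)]
  have m: "indicator {t..<t + d} \<in> borel_measurable halfline" for t
    by (intro measurable_restrict_space1 measurable_completion) auto
  have i: "integrable halfline (\<lambda>u. indicator {t..<t + d} u * \<phi> u)" for t
  proof (rule Bochner_Integration.integrable_bound[OF assms(2)])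
    note [measurable] = m
    show "(\<lambda>u. indicator {t..<t + d} u * \<phi> u) \<in> borel_measurable halfline"
      by measurable
  qed (auto simp: indicator_def)
  have one: "(\<Sum>t\<in>F. indicator {t..<t + d} u) \<le> (1 :: real)" for u
  proof -
    have "s = t" if "s \<in> F" "t \<in> F" "u \<in> {s..<s + d}" "u \<in> {t..<t + d}" for s t
      using sep[of s t] that by (cases "s = t") auto
    then have "card {t \<in> F. u \<in> {t..<t + d}} \<le> Suc 0"
      using assms(1) by (subst card_le_Suc0_iff_eq) auto
    moreover have "(\<Sum>t\<in>F. indicator {t..<t + d} u) = real (card {t \<in> F. u \<in> {t..<t + d}})"
      using assms(1) by (simp add: indicator_def sum.If_cases Int_def of_bool_def)
    ultimately show ?thesis by simp
  qed
  have "(\<Sum>t\<in>F. LINT u|halfline. indicator {t..<t + d} u * \<phi> u)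
      = (LINT u|halfline. (\<Sum>t\<in>F. indicator {t..<t + d} u) * \<phi> u)"
    using i by (simp add: sum_distrib_right Bochner_Integration.integral_sum)
  also have "\<dots> \<le> integral\<^sup>L halfline \<phi>"
  proof (rule integral_mono)
    show "integrable halfline (\<lambda>u. (\<Sum>t\<in>F. indicator {t..<t + d} u) * \<phi> u)"
      using i by (simp add: sum_distrib_right)
    show "(\<Sum>t\<in>F. indicator {t..<t + d} u) * \<phi> u \<le> \<phi> u" for u
      using mult_right_mono[OF one[of u] assms(3)[of u]] by simp
  qed (rule assms(2))
  finally show ?thesis .
qed

text \<open>The constant is chosen before \<open>h\<close> and \<open>F\<close>: uniformity in the
  finite set later yields summability over all sampling points.\<close>

lemma hankel_integral_sampling:
  assumes \<alpha>: "\<alpha> > - 1 / 2" and d: "d > 0" and R: "R > 0"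
  obtains C where "C \<ge> 0"
    "\<And>h F. h \<in> L2_halfline \<Longrightarrow> (\<And>x. x > R \<Longrightarrow> h x = 0) \<Longrightarrow> finite F \<Longrightarrow> F \<subseteq> {0<..} \<Longrightarrow>
      (\<And>s t. s \<in> F \<Longrightarrow> t \<in> F \<Longrightarrow> s \<noteq> t \<Longrightarrow> \<bar>s - t\<bar> \<ge> d) \<Longrightarrow>
      (\<Sum>t\<in>F. (cmod (hankel_integral \<alpha> h t))\<^sup>2) \<le> C * L2_sq h"
proof -
  obtain M where M: "M > 0" "\<And>f x. integrable halfline f \<Longrightarrow> x > 0 \<Longrightarrow>
      cmod (hankel_integral \<alpha> f x) \<le> M * (LINT t|halfline. cmod (f t))"
    using hankel_integral_bounded[OF \<alpha>] by blast
  define p where "p = \<alpha> + 1 / 2"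
  \<comment> \<open>The quotient collects the interval bounds, with the \<open>L^2\<close> bounds 2
    for G and 2 R^2 for G'. The summand \<open>M\<^sup>2 * R\<close> covers the possible single
    point below d, by the supremum bound and Cauchy-Schwarz on (0, R].\<close>
  define C where "C = ((2 + 4 * p\<^sup>2) * 2 + 4 * d\<^sup>2 * (2 * R\<^sup>2)) / d + M\<^sup>2 * R"
  show thesis
  proof (rule that[of C])
    show "C \<ge> 0" using d R by (simp add: C_def)
    fix h :: "real \<Rightarrow> complex" and F :: "real set"
    assume h: "h \<in> L2_halfline" "\<And>x. x > R \<Longrightarrow> h x = 0" and F: "finite F" "F \<subseteq> {0<..}"
      and sep: "\<And>s t. s \<in> F \<Longrightarrow> t \<in> F \<Longrightarrow> s \<noteq> t \<Longrightarrow> \<bar>s - t\<bar> \<ge> d"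
    define G where "G = hankel_integral \<alpha> h"
    define G' where "G' = hankel_integral (\<alpha> + 1) (\<lambda>x. of_real x * h x)"
    note hb = compact_support_L2[OF h(1) R h(2)]
    have G: "G \<in> L2_halfline" "L2_sq G \<le> 2 * L2_sq h"
      unfolding G_def using hankel_integral_L2_bound[OF \<alpha> hb(1) h(1)] by auto
    have G': "G' \<in> L2_halfline" "L2_sq G' \<le> 2 * R\<^sup>2 * L2_sq h"
      unfolding G'_def using hankel_integral_L2_bound[OF _ hb(4,3), of "\<alpha> + 1"] hb(5) \<alpha> by auto
    define \<phi> where "\<phi> u = (2 + 4 * p\<^sup>2) * (cmod (G u))\<^sup>2 + 4 * d\<^sup>2 * (cmod (G' u))\<^sup>2" for u
    have \<phi>: "integrable halfline \<phi>" "integral\<^sup>L halfline \<phi> = (2 + 4 * p\<^sup>2) * L2_sq G + 4 * d\<^sup>2 * L2_sq G'"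
      using L2_halflineD(2)[OF G(1)] L2_halflineD(2)[OF G'(1)]
      unfolding \<phi>_def[abs_def] L2_sq_def by simp_all
    let ?F1 = "{t \<in> F. t \<ge> d}" and ?F2 = "{t \<in> F. t < d}"
    have "d * (\<Sum>t\<in>?F1. (cmod (G t))\<^sup>2) = (\<Sum>t\<in>?F1. d * (cmod (G t))\<^sup>2)"
      by (simp add: sum_distrib_left)
    also have "\<dots> \<le> (\<Sum>t\<in>?F1. LINT u|halfline. indicator {t..<t + d} u * \<phi> u)"
      unfolding G_def \<phi>_def G'_def p_def
      using hankel_integral_point_bound[OF \<alpha> d _ hb(1) h(1) hb(4,3)] by (intro sum_mono) auto
    also have "\<dots> \<le> integral\<^sup>L halfline \<phi>"
      using F(1) sep by (intro sum_disjoint_interval_integrals_le \<phi>) (auto simp: \<phi>_def)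
    also have "\<dots> \<le> (2 + 4 * p\<^sup>2) * (2 * L2_sq h) + 4 * d\<^sup>2 * (2 * R\<^sup>2 * L2_sq h)"
      unfolding \<phi>(2) using G(2) G'(2) by (intro add_mono mult_left_mono) auto
    finally have 1: "(\<Sum>t\<in>?F1. (cmod (G t))\<^sup>2) \<le> ((2 + 4 * p\<^sup>2) * 2 + 4 * d\<^sup>2 * (2 * R\<^sup>2)) / d * L2_sq h"
      using d by (simp add: field_simps)
    have G_le: "(cmod (G t))\<^sup>2 \<le> M\<^sup>2 * R * L2_sq h" if "t \<in> F" for t
    proof -
      have "(cmod (G t))\<^sup>2 \<le> (M * (LINT x|halfline. cmod (h x)))\<^sup>2"
        unfolding G_def using M(2)[OF hb(1), of t] that F(2) by (intro power_mono) auto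
      also have "\<dots> \<le> M\<^sup>2 * (R * L2_sq h)"
        unfolding power_mult_distrib using hb(2) by (intro mult_left_mono) auto
      finally show ?thesis by simp
    qed
    have "card ?F2 \<le> Suc 0"
    proof (subst card_le_Suc0_iff_eq)
      have "s = t" if "s \<in> ?F2" "t \<in> ?F2" for s t
      proof (rule ccontr)
        assume "s \<noteq> t"
        then have "\<bar>s - t\<bar> \<ge> d" "s > 0" "t > 0"
          using sep that F(2) by auto
        then show False using that by auto
      qed
      then show "\<forall>s\<in>?F2. \<forall>t\<in>?F2. s = t" by blast
    qed (use F(1) in auto)
    then have "(\<Sum>t\<in>?F2. (cmod (G t))\<^sup>2) \<le> 1 * (M\<^sup>2 * R * L2_sq h)"
      using sum_bounded_above[of ?F2 "\<lambda>t. (cmod (G t))\<^sup>2" "M\<^sup>2 * R * L2_sq h"] G_le R L2_sq_nonneg[of h]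
      by (intro order_trans[OF sum_bounded_above mult_right_mono]) auto
    moreover have "(\<Sum>t\<in>F. (cmod (G t))\<^sup>2) = (\<Sum>t\<in>?F1. (cmod (G t))\<^sup>2) + (\<Sum>t\<in>?F2. (cmod (G t))\<^sup>2)"
      using F(1) by (subst sum.union_disjoint[symmetric]) (auto intro!: sum.cong)
    ultimately show "(\<Sum>t\<in>F. (cmod (hankel_integral \<alpha> h t))\<^sup>2) \<le> C * L2_sq h"
      using 1 unfolding G_def C_def by (simp add: distrib_right)
  qed
qed

text \<open>The second function enters only through its class in \<open>L^2\<close>, so a convenient
  representative may be chosen.\<close>

lemma has_hankel_transform_cong_AE:
  assumes "has_hankel_transform \<alpha> g h" "h' \<in> borel_measurable halfline" "AE x in halfline. h x = h' x"
  shows "has_hankel_transform \<alpha> g h'"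
proof -
  have h: "h \<in> L2_halfline" using assms(1) by (simp add: has_hankel_transform_def)
  note [measurable] = assms(2) L2_halflineD(1)[OF h]
  have "integrable halfline (\<lambda>x. (cmod (h' x))\<^sup>2)"
    using L2_halflineD(2)[OF h]
    by (rule integrable_cong_AE_imp) (use assms(3) in auto)
  then have h': "h' \<in> L2_halfline" by (simp add: L2_halfline_def)
  have norm_eq: "L2_norm (\<lambda>x. f x - h' x) = L2_norm (\<lambda>x. f x - h x)" if "f \<in> L2_halfline" for f
  proof -
    note [measurable] = L2_halflineD(1)[OF that]
    show ?thesis
      unfolding L2_norm_def
      by (intro arg_cong[of _ _ sqrt] integral_cong_AE) (use assms(3) in auto)
  qed
  obtain F where F: "\<forall>n. integrable halfline (F n) \<and> F n \<in> L2_halfline \<and>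
      hankel_integral \<alpha> (F n) \<in> L2_halfline" "(\<lambda>n. L2_norm (\<lambda>t. F n t - g t)) \<longlonglongrightarrow> 0"
    "(\<lambda>n. L2_norm (\<lambda>x. hankel_integral \<alpha> (F n) x - h x)) \<longlonglongrightarrow> 0" and g: "g \<in> L2_halfline"
    using assms(1) unfolding has_hankel_transform_def by blast
  have "(\<lambda>n. L2_norm (\<lambda>x. hankel_integral \<alpha> (F n) x - h' x)) \<longlonglongrightarrow> 0"
    using F(3) norm_eq F(1) by simp
  then show ?thesis
    unfolding has_hankel_transform_def using F(1,2) g h' by blast
qed

theorem proposition3:
  fixes \<alpha> d :: real and S T :: "real set"
  assumes "\<alpha> > - 1 / 2"
    and "S \<subseteq> {0<..}" and "bounded S" and "S \<in> sets lebesgue"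
    and "T \<subseteq> {0<..}" and "d > 0"
    and "\<And>s t. s \<in> T \<Longrightarrow> t \<in> T \<Longrightarrow> s \<noteq> t \<Longrightarrow> \<bar>s - t\<bar> \<ge> d"
  shows "\<exists>B. \<forall>g \<in> hankel_band_limited \<alpha> S. continuous_on {0<..} g \<longrightarrow>
           (\<lambda>t. (cmod (g t))\<^sup>2) summable_on T \<and>
           (\<Sum>\<^sub>\<infinity>t\<in>T. (cmod (g t))\<^sup>2) \<le> B * (L2_norm g)\<^sup>2"
proof -
  obtain R where "R > 0" and R_abs: "\<forall>x\<in>S. \<bar>x\<bar> \<le> R"
    using assms(3) by (auto simp: bounded_pos)
  then have R: "R > 0" "x \<in> S \<Longrightarrow> x \<le> R" for x
    by (auto simp: abs_le_iff)
  obtain C where C: "C \<ge> 0"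
    "\<And>h F. h \<in> L2_halfline \<Longrightarrow> (\<And>x. x > R \<Longrightarrow> h x = 0) \<Longrightarrow> finite F \<Longrightarrow> F \<subseteq> {0<..} \<Longrightarrow>
      (\<And>s t. s \<in> F \<Longrightarrow> t \<in> F \<Longrightarrow> s \<noteq> t \<Longrightarrow> \<bar>s - t\<bar> \<ge> d) \<Longrightarrow>
      (\<Sum>t\<in>F. (cmod (hankel_integral \<alpha> h t))\<^sup>2) \<le> C * L2_sq h"
    using hankel_integral_sampling[OF assms(1,6) R(1)] by metis
  show ?thesis
  proof (intro exI ballI impI)
    fix g assume "g \<in> hankel_band_limited \<alpha> S" and g: "continuous_on {0<..} g"
    then obtain h0 where h0: "has_hankel_transform \<alpha> g h0" "AE x in halfline. x \<notin> S \<longrightarrow> h0 x = 0"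
      unfolding hankel_band_limited_def by auto
    \<comment> \<open>The transform vanishes outside \<open>S\<close> only almost everywhere;
      cutting at \<open>R\<close> gives a representative that is 0 at every point beyond
      \<open>R\<close>.\<close>
    define h where "h x = indicator {..R} x * h0 x" for x
    have [measurable]: "h0 \<in> borel_measurable halfline"
      using h0(1) by (auto simp: has_hankel_transform_def dest: L2_halflineD)
    have h: "has_hankel_transform \<alpha> g h"
    proof (rule has_hankel_transform_cong_AE[OF h0(1)])
      show "h \<in> borel_measurable halfline"
        unfolding h_def[abs_def] by measurable
      show "AE x in halfline. h0 x = h x"
        using h0(2)
      proof eventually_elim
        case (elim x)
        then show ?case using R(2)[of x] by (cases "x \<in> S") (auto simp: h_def)
      qed
    qed
    then have hL2: "h \<in> L2_halfline" by (simp add: has_hankel_transform_def)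
    have hR: "h x = 0" if "x > R" for x using that by (simp add: h_def)
    have hi: "integrable halfline h"
      by (rule compact_support_L2(1)[OF hL2 R(1) hR])
    have g_eq: "g t = hankel_integral \<alpha> h t" if "t > 0" for t
      using continuous_AE_eq[OF g hankel_integral_continuous[OF assms(1) hi]
          hankel_inversion[OF assms(1) h hi] that] .
    \<comment> \<open>The constant is the sampling constant times the 8 from bounding the norm of h
      by that of g. Holding for all finite subsets, the bound gives both summability and the
      estimate of the infinite sum.\<close>
    have fin: "(\<Sum>t\<in>F. (cmod (g t))\<^sup>2) \<le> C * 8 * (L2_norm g)\<^sup>2" if "finite F" "F \<subseteq> T" for F
    proof -
      have "(\<Sum>t\<in>F. (cmod (g t))\<^sup>2) = (\<Sum>t\<in>F. (cmod (hankel_integral \<alpha> h t))\<^sup>2)"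
        using that assms(5) by (intro sum.cong) (auto simp: g_eq subset_iff)
      also have "\<dots> \<le> C * L2_sq h"
      proof (intro C(2) hL2 hR)
        show "\<bar>s - t\<bar> \<ge> d" if "s \<in> F" "t \<in> F" "s \<noteq> t" for s t
          using assms(7) that \<open>F \<subseteq> T\<close> by blast
      qed (use that assms(5) in auto)
      also have "\<dots> \<le> C * (8 * L2_sq g)"
        using has_hankel_transform_L2_bound[OF assms(1) h] C(1) by (rule mult_left_mono)
      finally show ?thesis by (simp add: L2_norm_power2)
    qed
    have "(\<lambda>t. (cmod (g t))\<^sup>2) summable_on T"
      using fin by (intro nonneg_bdd_above_summable_on) (auto intro!: bdd_aboveI)
    then show "(\<lambda>t. (cmod (g t))\<^sup>2) summable_on T \<and>
           (\<Sum>\<^sub>\<infinity>t\<in>T. (cmod (g t))\<^sup>2) \<le> C * 8 * (L2_norm g)\<^sup>2"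
      using fin by (auto intro: infsum_le_finite_sums)
  qed
qed

end
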